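(* Let $L=K\times K$, $\Delta=(1,p)$ and $n\ge1$. Then: (1) the map $(\alpha,m)\mapsto[u_\alpha\cdot(1,p^m)\cdot\mathcal{O}_n]$ is a bijection from $I(n)\times\mathbb{Z}$ onto the set of vertices of the Bruhat–Tits tree at distance exactly $n$ from the apartment with vertices $[\widetilde{\mathcal{O}}_m]$, $m\in\mathbb{Z}$; (2) for $1\le d\le n-1$, the map $\alpha\mapsto[u_\alpha\mathcal{O}_n]$ is a bijection from $I_d(n)$ onto the set of vertices at distance $d$ from $[\mathcal{O}_{n-d}]$ whose geodesic to $[\mathcal{O}_{n-d}]$ does not pass through $[\mathcal{O}_{n-d-1}]$; (3) only vertices of the form described in (2), for some $1\le d\le n-1$, can be the homothety class of a low ideal of $\mathcal{O}_n$.
   Context: $K$ is a nonarchimedean local field of characteristic zero with ring of integers $\mathcal{O}_K$ and uniformizer $p$; $L=K\times K$ with componentwise operations, $\mathcal{O}_L=\mathcal{O}_K\times\mathcal{O}_K=\mathcal{O}_K[\Delta]$ with $\Delta=(1,p)$, and $\mathcal{O}_k=\mathcal{O}_K[p^k\Delta]$ for $k\ge0$, with unit group $\mathcal{O}_k^*$. For $m\in\mathbb{Z}$, $\widetilde{\mathcal{O}}_m=(1,0)\mathcal{O}_K\oplus(0,p^m)\mathcal{O}_K$. $R(p)\subset\mathcal{O}_K$ is a set of representatives of $\mathcal{O}_K/p\mathcal{O}_K$; for $i\ge1$, $t\in R(p)$, $u^{(i)}_t=1+tp^i\Delta$; $R_0(p)=\{0,\dots,[\mathcal{O}_0^*:\mathcal{O}_1^*]-1\}$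 and $\{u^{(0)}_t:t\in R_0(p)\}$ is a fixed set of representatives of $\mathcal{O}_0^*/\mathcal{O}_1^*$. $I(n)=R_0(p)\times R(p)^{n-1}$ (tuples $(\alpha_0,\dots,\alpha_{n-1})$), and for $1\le d\le n-1$, $I_d(n)=R(p)^d$ (tuples $(\alpha_{n-d},\dots,\alpha_{n-1})$); $u_\alpha=u^{(n-d)}_{\alpha_{n-d}}\cdots u^{(n-1)}_{\alpha_{n-1}}$ (with $d=n$ for $I(n)$). The Bruhat–Tits tree of $SL(2,K)$ has vertices the $K^*$-homothety classes $[\Lambda]$ of $\mathcal{O}_K$-lattices in $L$ (scalars acting diagonally), adjacent iff representatives satisfy $p\Lambda\subsetneq\Lambda'\subsetneq\Lambda$. A low ideal of $\mathcal{O}_n$ is a principal ideal $I=(\alpha_1,\alpha_2)\mathcal{O}_n$ of finite index with $\min(v_p(\alpha_1),v_p(\alpha_2))<n$.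
   Formalization: Part (3) excludes the single case n = 1, I = O_1: there O_1 = (1,1)O_1 is a low ideal of O_1, but no d satisfies 1 ≤ d ≤ n−1 = 0, so the claim as stated fails; for n ≥ 2 nothing is changed. *)

theory Defs
  imports Complex_Main "HOL-Library.Product_Plus" "HOL-Library.Set_Algebras"
    "HOL-Library.Extended_Nat" "HOL-Library.FuncSet"
begin

subsection \<open>The product ring\<close>

instantiation prod :: (one, one) one
begin
definition one_prod_def: "1 = (1, 1)"
instance ..
end

instantiation prod :: (times, times) times
begin
definition times_prod_def: "x * y = (fst x * fst y, snd x * snd y)"
instance ..
end

lemma fst_one [simp]: "fst 1 = 1" and snd_one [simp]: "snd 1 = 1"
  by (simp_all add: one_prod_def)

lemma fst_mult [simp]: "fst (x * y) = fst x * fst y"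
  and snd_mult [simp]: "snd (x * y) = snd x * snd y"
  by (simp_all add: times_prod_def)

instance prod :: (comm_ring_1, comm_ring_1) comm_ring_1
  by standard (auto simp: prod_eq_iff algebra_simps)

definition diag :: "'a \<Rightarrow> 'a \<times> 'a" where
  "diag c = (c, c)"

subsection \<open>Nonarchimedean local fields of characteristic zero\<close>

text \<open>A valuation is given by its restriction to the nonzero elements; the value of the
  function at \<open>0\<close> is irrelevant, as every condition on valuations treats \<open>0\<close> as having
  valuation \<open>\<infinity>\<close>.\<close>

definition val_ge :: "('a::zero \<Rightarrow> int) \<Rightarrow> int \<Rightarrow> 'a \<Rightarrow> bool" where
  "val_ge v k x \<longleftrightarrow> x = 0 \<or> k \<le> v x"

definition int_ring :: "('a::zero \<Rightarrow> int) \<Rightarrow> 'a set" where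
  "int_ring v = {x. val_ge v 0 x}"

locale local_field =
  fixes v :: "'a::field_char_0 \<Rightarrow> int"
  assumes val_mult: "x \<noteq> 0 \<Longrightarrow> y \<noteq> 0 \<Longrightarrow> v (x * y) = v x + v y"
    and val_add: "x \<noteq> 0 \<Longrightarrow> y \<noteq> 0 \<Longrightarrow> x + y \<noteq> 0 \<Longrightarrow> min (v x) (v y) \<le> v (x + y)"
    and val_normalized: "\<exists>x. x \<noteq> 0 \<and> v x = 1"
    and complete:
      "(\<And>k. \<exists>N. \<forall>i\<ge>N. \<forall>j\<ge>N. val_ge v k (X i - X j)) \<Longrightarrow>
       \<exists>l. \<forall>k. \<exists>N. \<forall>i\<ge>N. val_ge v k ((X :: nat \<Rightarrow> 'a) i - l)"
    and finite_residue_field: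
      "finite (int_ring v // {(x, y). x \<in> int_ring v \<and> y \<in> int_ring v \<and> val_ge v 1 (x - y)})"

definition uniformizer :: "('a::zero \<Rightarrow> int) \<Rightarrow> 'a \<Rightarrow> bool" where
  "uniformizer v p \<longleftrightarrow> p \<noteq> 0 \<and> v p = 1"

subsection \<open>Orders and their units\<close>

definition Delta :: "'a::field \<Rightarrow> 'a \<times> 'a" where
  "Delta p = (1, p)"

definition adjoin :: "('a::field \<Rightarrow> int) \<Rightarrow> 'a \<times> 'a \<Rightarrow> ('a \<times> 'a) set" where
  "adjoin v x = {\<Sum>i\<le>N. diag (c i) * x ^ i | (N::nat) c. \<forall>i\<le>N. c i \<in> int_ring v}"

definition L_order :: "('a::field \<Rightarrow> int) \<Rightarrow> 'a \<Rightarrow> nat \<Rightarrow> ('a \<times> 'a) set" where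
  "L_order v p k = adjoin v (diag (p ^ k) * Delta p)"

definition L_order_units :: "('a::field \<Rightarrow> int) \<Rightarrow> 'a \<Rightarrow> nat \<Rightarrow> ('a \<times> 'a) set" where
  "L_order_units v p k = {x \<in> L_order v p k. \<exists>y \<in> L_order v p k. x * y = 1}"

definition tilde_order :: "('a::field \<Rightarrow> int) \<Rightarrow> 'a \<Rightarrow> int \<Rightarrow> ('a \<times> 'a) set" where
  "tilde_order v p m =
     {(1, 0) * diag a + (0, p powi m) * diag b | a b. a \<in> int_ring v \<and> b \<in> int_ring v}"

subsection \<open>Representatives and the elements \<open>u\<^sub>\<alpha>\<close>\<close>

definition residue_reps :: "('a::field \<Rightarrow> int) \<Rightarrow> 'a \<Rightarrow> 'a set \<Rightarrow> bool" where
  "residue_reps v p R \<longleftrightarrow>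
     R \<subseteq> int_ring v \<and> (\<forall>x \<in> int_ring v. \<exists>!r. r \<in> R \<and> x - r \<in> p *o int_ring v)"

definition unit_index :: "('a::field \<Rightarrow> int) \<Rightarrow> 'a \<Rightarrow> nat" where
  "unit_index v p = card ((\<lambda>x. x *o L_order_units v p 1) ` L_order_units v p 0)"

definition R0 :: "('a::field \<Rightarrow> int) \<Rightarrow> 'a \<Rightarrow> nat set" where
  "R0 v p = {0..<unit_index v p}"

definition unit_reps :: "('a::field \<Rightarrow> int) \<Rightarrow> 'a \<Rightarrow> (nat \<Rightarrow> 'a \<times> 'a) \<Rightarrow> bool" where
  "unit_reps v p u0 \<longleftrightarrow>
     (\<forall>t \<in> R0 v p. u0 t \<in> L_order_units v p 0) \<and>
     (\<forall>x \<in> L_order_units v p 0. \<exists>!t. t \<in> R0 v p \<and> x \<in> u0 t *o L_order_units v p 1)"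

definition u_elem :: "'a::field \<Rightarrow> nat \<Rightarrow> 'a \<Rightarrow> 'a \<times> 'a" where
  "u_elem p i t = 1 + diag (t * p ^ i) * Delta p"

text \<open>A tuple \<open>(\<alpha>\<^sub>0, \<dots>, \<alpha>\<^bsub>n-1\<^esub>)\<close> of \<open>I(n)\<close> is the pair of \<open>\<alpha>\<^sub>0\<close> and the family of the
  remaining entries, which live in a different type.\<close>

definition tuples ::
    "('a::field \<Rightarrow> int) \<Rightarrow> 'a \<Rightarrow> 'a set \<Rightarrow> nat \<Rightarrow> (nat \<times> (nat \<Rightarrow> 'a)) set" where
  "tuples v p R n = R0 v p \<times> ({1..<n} \<rightarrow>\<^sub>E R)"

definition partial_tuples :: "'a set \<Rightarrow> nat \<Rightarrow> nat \<Rightarrow> (nat \<Rightarrow> 'a) set" where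
  "partial_tuples R n d = ({n - d..<n} \<rightarrow>\<^sub>E R)"

definition u_partial :: "'a::field \<Rightarrow> nat \<Rightarrow> nat \<Rightarrow> (nat \<Rightarrow> 'a) \<Rightarrow> 'a \<times> 'a" where
  "u_partial p n d \<alpha> = (\<Prod>i\<in>{n - d..<n}. u_elem p i (\<alpha> i))"

definition u_full ::
    "'a::field \<Rightarrow> (nat \<Rightarrow> 'a \<times> 'a) \<Rightarrow> nat \<Rightarrow> nat \<times> (nat \<Rightarrow> 'a) \<Rightarrow> 'a \<times> 'a" where
  "u_full p u0 n \<alpha> = u0 (fst \<alpha>) * (\<Prod>i\<in>{1..<n}. u_elem p i (snd \<alpha> i))"

subsection \<open>The Bruhat--Tits tree\<close>

definition is_lattice :: "('a::field \<Rightarrow> int) \<Rightarrow> ('a \<times> 'a) set \<Rightarrow> bool" where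
  "is_lattice v \<Lambda> \<longleftrightarrow>
     (\<exists>x y. (\<forall>z. \<exists>!c. z = diag (fst c) * x + diag (snd c) * y) \<and>
            \<Lambda> = {diag a * x + diag b * y | a b. a \<in> int_ring v \<and> b \<in> int_ring v})"

definition hclass :: "('a::field \<times> 'a) set \<Rightarrow> ('a \<times> 'a) set set" where
  "hclass \<Lambda> = {diag c *o \<Lambda> | c. c \<noteq> 0}"

definition bt_vertices :: "('a::field \<Rightarrow> int) \<Rightarrow> ('a \<times> 'a) set set set" where
  "bt_vertices v = hclass ` {\<Lambda>. is_lattice v \<Lambda>}"

definition bt_adj :: "'a::field \<Rightarrow> ('a \<times> 'a) set set \<Rightarrow> ('a \<times> 'a) set set \<Rightarrow> bool" where
  "bt_adj p x y \<longleftrightarrow> (\<exists>\<Lambda> \<in> x. \<exists>\<Lambda>' \<in> y. diag p *o \<Lambda> \<subset> \<Lambda>' \<and> \<Lambda>' \<subset> \<Lambda>)"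

definition bt_walk :: "('a::field \<Rightarrow> int) \<Rightarrow> 'a \<Rightarrow> ('a \<times> 'a) set set \<Rightarrow>
    ('a \<times> 'a) set set list \<Rightarrow> ('a \<times> 'a) set set \<Rightarrow> bool" where
  "bt_walk v p x xs y \<longleftrightarrow>
     xs \<noteq> [] \<and> hd xs = x \<and> last xs = y \<and> set xs \<subseteq> bt_vertices v \<and> successively (bt_adj p) xs"

definition bt_dist :: "('a::field \<Rightarrow> int) \<Rightarrow> 'a \<Rightarrow> ('a \<times> 'a) set set \<Rightarrow>
    ('a \<times> 'a) set set \<Rightarrow> enat" where
  "bt_dist v p x y = (INF xs \<in> {xs. bt_walk v p x xs y}. enat (length xs - 1))"

definition bt_geodesic :: "('a::field \<Rightarrow> int) \<Rightarrow> 'a \<Rightarrow> ('a \<times> 'a) set set \<Rightarrow>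
    ('a \<times> 'a) set set list \<Rightarrow> ('a \<times> 'a) set set \<Rightarrow> bool" where
  "bt_geodesic v p x xs y \<longleftrightarrow> bt_walk v p x xs y \<and> enat (length xs - 1) = bt_dist v p x y"

definition apartment_dist :: "('a::field \<Rightarrow> int) \<Rightarrow> 'a \<Rightarrow> ('a \<times> 'a) set set \<Rightarrow> enat" where
  "apartment_dist v p x = (INF m. bt_dist v p x (hclass (tilde_order v p m)))"

subsection \<open>Low ideals\<close>

definition low_ideal :: "('a::field \<Rightarrow> int) \<Rightarrow> 'a \<Rightarrow> nat \<Rightarrow> ('a \<times> 'a) set \<Rightarrow> bool" where
  "low_ideal v p n I \<longleftrightarrow>
     (\<exists>a1 a2. (a1, a2) \<in> L_order v p n \<and> I = (a1, a2) *o L_order v p n \<and>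
        finite (L_order v p n // {(x, y). x \<in> L_order v p n \<and> y \<in> L_order v p n \<and> x - y \<in> I}) \<and>
        \<not> (val_ge v (int n) a1 \<and> val_ge v (int n) a2))"

text \<open>The order itself is always a low ideal. In particular \<open>\<O>\<^sub>1\<close> is a low ideal of \<open>\<O>\<^sub>1\<close>,
  although there is no \<open>d\<close> with \<open>1 \<le> d \<le> 1 - 1\<close>.\<close>

lemma low_ideal_L_order:
  assumes "local_field v" "n \<ge> 1"
  shows "low_ideal v p n (L_order v p n)"
proof -
  interpret local_field v by fact
  let ?O = "L_order v p n"
  have v1: "v 1 = 0" using val_mult[of 1 1] by simp
  have one: "(1, 1) \<in> ?O"
    unfolding L_order_def adjoin_def mem_Collect_eq
    by (rule exI[of _ 0], rule exI[of _ "\<lambda>_. 1"])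
      (simp add: int_ring_def val_ge_def v1 diag_def)
  have id: "?O = (1, 1) *o ?O"
    by (auto simp: elt_set_times_def times_prod_def)
  have diff: "x - y \<in> ?O" if xy: "x \<in> ?O" "y \<in> ?O" for x y
  proof -
    let ?x = "diag (p ^ n) * Delta p"
    have diff_int: "a - b \<in> int_ring v" if "a \<in> int_ring v" "b \<in> int_ring v" for a b
    proof -
      have "v (- 1) = 0" using val_mult[of "-1" "-1"] v1 by simp
      then have "v (- b) = v b" if "b \<noteq> 0" for b using val_mult[of "-1" b] that by simp
      then show ?thesis using that val_add[of a "- b"]
        by (cases "a = b"; cases "a = 0"; cases "b = 0") (auto simp: int_ring_def val_ge_def)
    qed
    have zero_int: "0 \<in> int_ring v" by (simp add: int_ring_def val_ge_def)
    obtain N c where c: "x = (\<Sum>i\<le>N. diag (c i) * ?x ^ i)" "\<forall>i\<le>N. c i \<in> int_ring v"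
      using xy(1) unfolding L_order_def adjoin_def by blast
    obtain M e where e: "y = (\<Sum>i\<le>M. diag (e i) * ?x ^ i)" "\<forall>i\<le>M. e i \<in> int_ring v"
      using xy(2) unfolding L_order_def adjoin_def by blast
    define c' where "c' i = (if i \<le> N then c i else 0)" for i
    define e' where "e' i = (if i \<le> M then e i else 0)" for i
    have d0: "diag 0 = (0 :: 'a \<times> 'a)" by (simp add: diag_def zero_prod_def)
    have "x = (\<Sum>i\<le>max N M. diag (c' i) * ?x ^ i)"
      unfolding c(1) by (rule sum.mono_neutral_cong_left) (auto simp: c'_def d0)
    moreover have "y = (\<Sum>i\<le>max N M. diag (e' i) * ?x ^ i)"
      unfolding e(1) by (rule sum.mono_neutral_cong_left) (auto simp: e'_def d0)
    ultimately have "x - y = (\<Sum>i\<le>max N M. diag (c' i - e' i) * ?x ^ i)"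
      by (simp add: sum_subtractf[symmetric] diag_def left_diff_distrib[symmetric])
    moreover have "\<forall>i\<le>max N M. c' i - e' i \<in> int_ring v"
      by (intro allI impI diff_int) (use c(2) e(2) zero_int in \<open>auto simp: c'_def e'_def\<close>)
    ultimately show ?thesis unfolding L_order_def adjoin_def mem_Collect_eq
      by (intro exI[of _ "max N M"] exI[of _ "\<lambda>i. c' i - e' i"]) simp
  qed
  have "?O // {(x, y). x \<in> ?O \<and> y \<in> ?O \<and> x - y \<in> ?O} \<subseteq> {?O}"
    using diff by (auto simp: quotient_def)
  then have "finite (?O // {(x, y). x \<in> ?O \<and> y \<in> ?O \<and> x - y \<in> ?O})"
    by (rule finite_subset) simp
  then show ?thesis
    unfolding low_ideal_def using one id assms(2) v1
    by (intro exI[of _ 1]) (auto simp: val_ge_def)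
qed

end

theory Submission
  imports Defs
begin

text \<open>
  Up to homothety every lattice is \<open>{(x, y). x \<in> \<O>, y - b x \<in> p\<^sup>N\<O>}\<close>, so the vertices of the
  tree are the balls \<open>b + p\<^sup>N\<O>\<close> of \<open>K\<close>, two balls being adjacent iff one contains the other
  and their exponents \<open>N\<close> differ by one. The apartment consists of the balls containing \<open>0\<close>, the order
  \<open>\<O>\<^sub>k\<close> is the ball \<open>1 + p\<^sup>k\<O>\<close>, and \<open>(a, b) \<O>\<^sub>n\<close> is the ball around \<open>b / a\<close> of exponent
  \<open>n + v(b) - v(a)\<close>. Hence a vertex at distance \<open>n \<ge> 1\<close> from the apartment is a ball
  \<open>b + p\<^bsup>n + v(b)\<^esup>\<O>\<close> with \<open>b \<noteq> 0\<close>, and the vertices that are separated from \<open>\<O>\<^bsub>k-1\<^esub>\<close> by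
  \<open>\<O>\<^sub>k\<close> are the balls inside \<open>1 + p\<^sup>k\<O>\<close>. It remains to see that the ratios of
  coordinates of the \<open>u\<^sub>\<alpha>\<close> represent the units modulo \<open>1 + p\<^sup>n\<O>\<close>, which follows by determining
  the digits \<open>\<alpha>\<^sub>i\<close> one after the other.
\<close>

subsection \<open>Valuation estimates\<close>

locale uniformized_local_field = local_field v for v :: "'a::field_char_0 \<Rightarrow> int" +
  fixes p :: 'a
  assumes uniformizer: "uniformizer v p"
begin

abbreviation "ge \<equiv> val_ge v"

lemma p_nz [simp]: "p \<noteq> 0" and val_p [simp]: "v p = 1"
  using uniformizer by (auto simp: uniformizer_def)

lemma val_one [simp]: "v 1 = 0"
  using val_mult[of 1 1] by simp

lemma val_minus [simp]: "v (- x) = v x"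
proof (cases "x = 0")
  case False
  have "v (- 1) = 0" using val_mult[of "-1" "-1"] by simp
  then show ?thesis using val_mult[of "-1" x] False by simp
qed simp

lemma val_inverse: "x \<noteq> 0 \<Longrightarrow> v (inverse x) = - v x"
  using val_mult[of x "inverse x"] by simp

lemma val_divide: "x \<noteq> 0 \<Longrightarrow> y \<noteq> 0 \<Longrightarrow> v (x / y) = v x - v y"
  using val_mult[of x "inverse y"] by (simp add: val_inverse divide_inverse)

lemma val_power [simp]: "v (p ^ k) = int k"
  by (induction k) (simp_all add: val_mult)

lemma val_powi [simp]: "v (p powi k) = k"
  by (cases "k \<ge> 0") (simp_all add: power_int_def val_inverse power_inverse)

lemma ge_zero [simp]: "ge k 0"
  by (simp add: val_ge_def)

lemma ge_nonzero: "x \<noteq> 0 \<Longrightarrow> ge k x \<longleftrightarrow> k \<le> v x"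
  by (simp add: val_ge_def)

lemma ge_add: "ge k x \<Longrightarrow> ge k y \<Longrightarrow> ge k (x + y)"
  using val_add[of x y] by (cases "x = 0"; cases "y = 0"; cases "x + y = 0") (auto simp: val_ge_def)

lemma ge_minus [simp]: "ge k (- x) \<longleftrightarrow> ge k x"
  by (simp add: val_ge_def)

lemma ge_diff: "ge k x \<Longrightarrow> ge k y \<Longrightarrow> ge k (x - y)"
  using ge_add[of k x "- y"] by simp

lemma ge_commute: "ge k (x - y) \<longleftrightarrow> ge k (y - x)"
  using ge_minus[of k "x - y"] by simp

lemma ge_trans: "ge k (x - y) \<Longrightarrow> ge k (y - z) \<Longrightarrow> ge k (x - z)"
  using ge_add[of k "x - y" "y - z"] by simp

lemma ge_mono: "ge k x \<Longrightarrow> j \<le> k \<Longrightarrow> ge j x"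
  by (auto simp: val_ge_def)

lemma ge_mult: "ge k x \<Longrightarrow> ge j y \<Longrightarrow> ge (k + j) (x * y)"
  by (cases "x = 0"; cases "y = 0") (auto simp: val_ge_def val_mult)

lemma ge_mult_left_iff: "c \<noteq> 0 \<Longrightarrow> ge k (c * x) \<longleftrightarrow> ge (k - v c) x"
  by (cases "x = 0") (auto simp: val_ge_def val_mult)

lemma ge_divide_iff: "c \<noteq> 0 \<Longrightarrow> ge k (x / c) \<longleftrightarrow> ge (k + v c) x"
  by (cases "x = 0") (auto simp: val_ge_def val_divide)

lemma ge_one [simp]: "ge k 1 \<longleftrightarrow> k \<le> 0"
  by (simp add: val_ge_def)

lemma int_ring_iff [simp]: "x \<in> int_ring v \<longleftrightarrow> ge 0 x"
  by (simp add: int_ring_def)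

text \<open>The equality case of the ultrametric inequality: if the valuation of \<open>x\<close>
  exceeded \<open>v y\<close>, then so would that of \<open>y = x - (x - y)\<close>.\<close>

lemma val_eqI: "ge k (x - y) \<Longrightarrow> y \<noteq> 0 \<Longrightarrow> v y < k \<Longrightarrow> x \<noteq> 0 \<and> v x = v y"
proof -
  assume a: "ge k (x - y)" "y \<noteq> 0" "v y < k"
  then have x: "x \<noteq> 0" by (auto simp: val_ge_def)
  have "ge (v y) x"
    using ge_add[OF ge_mono[OF a(1), of "v y"], of y] a by (simp add: val_ge_def)
  moreover have "\<not> ge (v y + 1) x"
  proof
    assume "ge (v y + 1) x"
    from ge_diff[OF this ge_mono[OF a(1)]] a(3) have "ge (v y + 1) y" by simp
    then show False using a(2) by (simp add: val_ge_def)
  qed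
  ultimately show ?thesis using x by (auto simp: val_ge_def)
qed

lemma one_unit: "ge 1 (x - 1) \<Longrightarrow> x \<noteq> 0 \<and> v x = 0"
  using val_eqI[of 1 x 1] by simp

subsection \<open>Vertices as balls\<close>

text \<open>The lattice with basis \<open>(p powi k, b * p powi k)\<close>,
  \<open>(0, p powi N)\<close>, that is, a triangular normal form. The slope \<open>b\<close>
  matters only modulo \<open>p powi (N - k)\<close>.\<close>

definition lat :: "int \<Rightarrow> 'a \<Rightarrow> int \<Rightarrow> ('a \<times> 'a) set" where
  "lat k b N = {(x, y). ge k x \<and> ge N (y - b * x)}"

definition ball_vertex :: "'a \<Rightarrow> int \<Rightarrow> ('a \<times> 'a) set set" where
  "ball_vertex b N = hclass (lat 0 b N)"

text \<open>Inclusion can be tested on the two basis vectors. Conversely, \<open>y - b' * x\<close>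
  is \<open>y - b * x\<close> corrected by \<open>(b - b') * x\<close>.\<close>

lemma lat_subset_iff:
  "lat k b N \<subseteq> lat k' b' N' \<longleftrightarrow> k' \<le> k \<and> N' \<le> N \<and> ge (N' - k) (b - b')"
proof
  assume s: "lat k b N \<subseteq> lat k' b' N'"
  have "(p powi k, b * p powi k) \<in> lat k' b' N'"
    using s by (rule subsetD) (simp add: lat_def val_ge_def)
  moreover have "(0, p powi N) \<in> lat k' b' N'"
    using s by (rule subsetD) (simp add: lat_def val_ge_def)
  moreover have "b * p powi k - b' * p powi k = p powi k * (b - b')"
    by (simp add: algebra_simps)
  ultimately show "k' \<le> k \<and> N' \<le> N \<and> ge (N' - k) (b - b')"
    by (simp add: lat_def ge_mult_left_iff) (simp add: val_ge_def)
next
  assume a: "k' \<le> k \<and> N' \<le> N \<and> ge (N' - k) (b - b')"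
  show "lat k b N \<subseteq> lat k' b' N'"
  proof (clarsimp simp: lat_def)
    fix x y assume xy: "ge k x" "ge N (y - b * x)"
    have "ge N' ((y - b * x) + (b - b') * x)"
      using a xy ge_mult[of "N' - k" "b - b'" k x] by (intro ge_add) (auto intro: ge_mono)
    then show "ge k' x \<and> ge N' (y - b' * x)"
      using a xy by (auto simp: algebra_simps intro: ge_mono)
  qed
qed

lemma lat_eq_iff: "lat k b N = lat k' b' N' \<longleftrightarrow> k = k' \<and> N = N' \<and> ge (N - k) (b - b')"
  unfolding set_eq_subset lat_subset_iff by (auto simp: ge_commute)

text \<open>From \<open>d * y - (b * d / c) * (c * x) = d * (y - b * x)\<close>: the slope is
  multiplied by \<open>d / c\<close>, and each exponent is shifted by the valuation of its own
  factor.\<close>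

lemma times_lat:
  assumes "c \<noteq> 0" "d \<noteq> 0"
  shows "(c, d) *o lat k b N = lat (k + v c) (b * d / c) (N + v d)"
proof (rule set_eqI, clarify)
  fix x y
  have "(x, y) \<in> (c, d) *o lat k b N \<longleftrightarrow> (x / c, y / d) \<in> lat k b N"
  proof
    assume "(x, y) \<in> (c, d) *o lat k b N"
    then show "(x / c, y / d) \<in> lat k b N"
      using assms by (auto simp: elt_set_times_def times_prod_def)
  next
    assume "(x / c, y / d) \<in> lat k b N"
    then show "(x, y) \<in> (c, d) *o lat k b N"
      using assms by (auto simp: elt_set_times_def times_prod_def intro!: bexI[of _ "(x / c, y / d)"])
  qed
  also have "\<dots> \<longleftrightarrow> (x, y) \<in> lat (k + v c) (b * d / c) (N + v d)"
  proof -
    have "y / d - b * (x / c) = (y - b * d / c * x) / d" using assms by (simp add: field_simps)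
    then show ?thesis using assms by (simp add: lat_def ge_divide_iff)
  qed
  finally show "(x, y) \<in> (c, d) *o lat k b N \<longleftrightarrow>
    (x, y) \<in> lat (k + v c) (b * d / c) (N + v d)" .
qed

lemma diag_lat: "c \<noteq> 0 \<Longrightarrow> diag c *o lat k b N = lat (k + v c) b (N + v c)"
  by (simp add: diag_def times_lat)

text \<open>Unit scalars fix the lattice, so its multiples are indexed by the valuation
  \<open>j - k\<close> of the scalar; slope and \<open>N - k\<close> are the invariants of the
  class.\<close>

lemma hclass_lat: "hclass (lat k b N) = range (\<lambda>j. lat j b (N - k + j))"
proof (rule set_eqI, rule iffI)
  fix X assume "X \<in> hclass (lat k b N)"
  then obtain c where "c \<noteq> 0" "X = diag c *o lat k b N" by (auto simp: hclass_def)
  then have "X = lat (k + v c) b (N - k + (k + v c))" by (simp add: diag_lat)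
  then show "X \<in> range (\<lambda>j. lat j b (N - k + j))" by blast
next
  fix X assume "X \<in> range (\<lambda>j. lat j b (N - k + j))"
  then obtain j where "X = lat j b (N - k + j)" by blast
  then have "X = diag (p powi (j - k)) *o lat k b N" by (simp add: diag_lat algebra_simps)
  then show "X \<in> hclass (lat k b N)" unfolding hclass_def by (auto intro!: exI[of _ "p powi (j - k)"])
qed

lemma hclass_lat_ball: "hclass (lat k b N) = ball_vertex b (N - k)"
  by (simp add: ball_vertex_def hclass_lat)

lemma lat_in_ball_vertex [simp]: "lat k b (N + k) \<in> ball_vertex b N"
  unfolding ball_vertex_def hclass_lat by simp

lemma ball_vertex_eq_iff:
  "ball_vertex b N = ball_vertex b' N' \<longleftrightarrow> N = N' \<and> ge N (b - b')"
proof
  assume "ball_vertex b N = ball_vertex b' N'"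
  moreover have "lat 0 b N \<in> ball_vertex b N" using lat_in_ball_vertex[of 0] by simp
  ultimately obtain j where "lat 0 b N = lat j b' (N' + j)"
    by (auto simp: ball_vertex_def hclass_lat)
  then show "N = N' \<and> ge N (b - b')" by (auto simp: lat_eq_iff)
next
  assume "N = N' \<and> ge N (b - b')"
  then have "lat 0 b N = lat 0 b' N'" by (auto simp: lat_eq_iff)
  then show "ball_vertex b N = ball_vertex b' N'" by (simp add: ball_vertex_def)
qed

lemma adj_ball_iff:
  "bt_adj p (ball_vertex b N) (ball_vertex b' N') \<longleftrightarrow>
     N' = N + 1 \<and> ge N (b - b') \<or> N = N' + 1 \<and> ge N' (b - b')" (is "?L \<longleftrightarrow> ?R")
proof
  assume ?L
  then obtain k k' where "lat (k + 1) b (N + k + 1) \<subset> lat k' b' (N' + k')"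
      "lat k' b' (N' + k') \<subset> lat k b (N + k)"
    by (auto simp: bt_adj_def ball_vertex_def hclass_lat diag_lat)
  then have a: "k' \<le> k + 1" "N' + k' \<le> N + k + 1" "ge (N' + k' - (k + 1)) (b - b')"
    "\<not> (k + 1 \<le> k' \<and> N + k + 1 \<le> N' + k' \<and> ge (N + k + 1 - k') (b - b'))"
    "k \<le> k'" "N + k \<le> N' + k'" "ge (N + k - k') (b - b')"
    "\<not> (k' \<le> k \<and> N' + k' \<le> N + k \<and> ge (N' + k' - k) (b - b'))"
    unfolding less_le_not_le lat_subset_iff by (auto simp: ge_commute[of _ b' b])
  \<comment> \<open>For \<open>k' = k\<close> the second ball is the smaller one, for
    \<open>k' = k + 1\<close> the larger one. In both cases \<open>N' = N\<close> would turn one of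
    the strict inclusions into an equality.\<close>
  consider "k' = k" | "k' = k + 1" using a by linarith
  then show ?R
  proof cases
    case 1
    then have "N' = N + 1" using a by (cases "N' = N") auto
    then show ?thesis using a 1 by auto
  next
    case 2
    then have "N = N' + 1" using a by (cases "N' = N") auto
    then show ?thesis using a 2 by auto
  qed
next
  assume ?R
  then show ?L
  proof
    assume a: "N' = N + 1 \<and> ge N (b - b')"
    have "diag p *o lat 0 b N \<subset> lat 0 b' N'" "lat 0 b' N' \<subset> lat 0 b N"
      unfolding less_le_not_le using a
      by (auto simp: diag_lat lat_subset_iff ge_commute[of _ b' b])
    moreover have "lat 0 b N \<in> ball_vertex b N" "lat 0 b' N' \<in> ball_vertex b' N'"
      using lat_in_ball_vertex[of 0] by simp_all
    ultimately show ?L unfolding bt_adj_def by blast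
  next
    assume a: "N = N' + 1 \<and> ge N' (b - b')"
    \<comment> \<open>The larger ball gives the larger lattice at index 0, so its multiple by
      \<open>p\<close> is the representative lying in between.\<close>
    have "diag p *o lat 0 b N \<subset> lat 1 b' (N' + 1)" "lat 1 b' (N' + 1) \<subset> lat 0 b N"
      unfolding less_le_not_le using a
      by (auto simp: diag_lat lat_subset_iff ge_commute[of _ b' b] elim: ge_mono)
    moreover have "lat 0 b N \<in> ball_vertex b N" "lat 1 b' (N' + 1) \<in> ball_vertex b' N'"
      using lat_in_ball_vertex[of 0 b N] by simp_all
    ultimately show ?L unfolding bt_adj_def by blast
  qed
qed

section \<open>Balls are exactly the vertices\<close>

lemma ball_lattice: "is_lattice v (lat 0 b N)"
  unfolding is_lattice_def
proof (intro exI conjI allI)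
  fix z :: "'a \<times> 'a"
  show "\<exists>!c. z = diag (fst c) * (1, b) + diag (snd c) * (0, p powi N)"
    by (rule ex1I[of _ "(fst z, (snd z - b * fst z) / p powi N)"])
      (auto simp: prod_eq_iff diag_def field_simps)
next
  show "lat 0 b N = {diag c * (1, b) + diag d * (0, p powi N) |c d.
      c \<in> int_ring v \<and> d \<in> int_ring v}" (is "_ = ?S")
  proof (rule set_eqI, rule iffI)
    fix z assume "z \<in> lat 0 b N"
    then have "ge 0 (fst z)" "ge 0 ((snd z - b * fst z) / p powi N)"
      by (auto simp: lat_def ge_divide_iff)
    moreover have "z = diag (fst z) * (1, b) + diag ((snd z - b * fst z) / p powi N) * (0, p powi N)"
      by (auto simp: prod_eq_iff diag_def field_simps)
    ultimately show "z \<in> ?S" by auto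
  next
    fix z assume "z \<in> ?S"
    then obtain c d where z: "z = diag c * (1, b) + diag d * (0, p powi N)" "ge 0 c" "ge 0 d"
      by auto
    have "z = (c, p powi N * d + b * c)" by (simp add: z prod_eq_iff diag_def)
    then show "z \<in> lat 0 b N" using z(2,3) by (simp add: lat_def ge_mult_left_iff)
  qed
qed

lemma ball_vertex_in [simp]: "ball_vertex b N \<in> bt_vertices v"
  using ball_lattice by (auto simp: bt_vertices_def ball_vertex_def)

text \<open>Column reduction: as \<open>fst x\<close> divides \<open>fst y\<close> in the integers,
  subtracting a multiple of \<open>x\<close> from \<open>y\<close> leaves \<open>(0, e)\<close>, and
  the lattice is triangular with slope \<open>x2 / x1\<close>.\<close>

lemma basis_lattice_eq_lat:
  assumes basis: "\<forall>z. \<exists>!c. z = diag (fst c) * x + diag (snd c) * (y :: 'a \<times> 'a)"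
    and x: "fst x \<noteq> 0" and y: "fst y = 0 \<or> v (fst x) \<le> v (fst y)"
  shows "\<exists>k b N. {diag a * x + diag b * y |a b. a \<in> int_ring v \<and> b \<in> int_ring v} = lat k b N"
proof -
  obtain x1 x2 y1 y2 where xy: "x = (x1, x2)" "y = (y1, y2)" by (metis surj_pair)
  define e where "e = y2 - x2 / x1 * y1"
  have x1: "x1 \<noteq> 0" using x xy by simp
  have e: "e \<noteq> 0"
  proof
    assume "e = 0"
    \<comment> \<open>With \<open>e = 0\<close> the reduction would be a nontrivial relation between
      the basis vectors, against uniqueness of coordinates.\<close>
    then have "0 = diag (fst (- y1 / x1, 1)) * x + diag (snd (- y1 / x1, 1)) * y"
      "0 = diag (fst (0, 0)) * x + diag (snd (0, 0)) * y"
      using x1 by (auto simp: xy e_def prod_eq_iff diag_def field_simps)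
    then have "(- y1 / x1, 1) = (0 :: 'a, 0 :: 'a)" using basis by blast
    then show False by simp
  qed
  have q: "ge 0 (y1 / x1)"
    using y xy x1 by (auto simp: ge_divide_iff) (auto simp: val_ge_def)
  have "{diag a * x + diag b * y |a b. a \<in> int_ring v \<and> b \<in> int_ring v} = lat (v x1) (x2 / x1) (v e)"
    (is "?S = _")
  proof (rule set_eqI, rule iffI)
    fix z assume "z \<in> ?S"
    then obtain a b where z: "z = diag a * x + diag b * y" "ge 0 a" "ge 0 b" by auto
    have 1: "fst z = x1 * (a + b * (y1 / x1))" using x1 by (simp add: z xy diag_def field_simps)
    have 2: "snd z - x2 / x1 * fst z = e * b"
      using x1 by (simp add: z xy diag_def e_def field_simps)
    have "ge 0 (a + b * (y1 / x1))"
      using z q ge_mult[of 0 b 0 "y1 / x1"] by (intro ge_add) auto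
    then have "ge (v x1) (x1 * (a + b * (y1 / x1)))" "ge (v e) (e * b)"
      using x1 e z(3) by (simp_all add: ge_mult_left_iff)
    then have "ge (v x1) (fst z)" "ge (v e) (snd z - x2 / x1 * fst z)"
      by (simp only: 1, simp only: 2)
    then show "z \<in> lat (v x1) (x2 / x1) (v e)" by (simp add: lat_def case_prod_beta)
  next
    fix z assume "z \<in> lat (v x1) (x2 / x1) (v e)"
    then have z: "ge (v x1) (fst z)" "ge (v e) (snd z - x2 / x1 * fst z)" by (auto simp: lat_def)
    define b where "b = (snd z - x2 / x1 * fst z) / e"
    define a where "a = fst z / x1 - b * (y1 / x1)"
    have b: "ge 0 b" using z e by (simp add: b_def ge_divide_iff)
    have a: "ge 0 a" unfolding a_def
      using z x1 ge_mult[OF b q] by (intro ge_diff) (auto simp: ge_divide_iff)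
    have be: "snd z = x2 / x1 * fst z + b * e" using e by (simp add: b_def)
    have "fst z = a * x1 + b * y1" using x1 by (simp add: a_def field_simps)
    moreover have "snd z = a * x2 + b * y2"
      unfolding be using x1 by (simp add: a_def e_def field_simps)
    ultimately have "z = diag a * x + diag b * y" by (simp add: prod_eq_iff diag_def xy)
    then show "z \<in> ?S" using a b by auto
  qed
  then show ?thesis by blast
qed

text \<open>After exchanging the basis vectors if necessary, the first one has a nonzero first
  coordinate of minimal valuation, and \<open>basis_lattice_eq_lat\<close> applies.\<close>

lemma vertex_ball:
  assumes "X \<in> bt_vertices v"
  obtains b N where "X = ball_vertex b N"
proof -
  obtain x y :: "'a \<times> 'a" where basis: "\<forall>z. \<exists>!c. z = diag (fst c) * x + diag (snd c) * y"
    and X: "X = hclass {diag a * x + diag b * y |a b. a \<in> int_ring v \<and> b \<in> int_ring v}"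
    using assms by (auto simp: bt_vertices_def is_lattice_def)
  let ?S = "\<lambda>x y. {diag a * x + diag b * y |a b. a \<in> int_ring v \<and> b \<in> int_ring v}"
  have swap: "?S x y = ?S y x" by (auto simp: add.commute) (metis add.commute)+
  have basis': "\<forall>z. \<exists>!c. z = diag (fst c) * y + diag (snd c) * x"
  proof
    fix z
    obtain c where c: "z = diag (fst c) * x + diag (snd c) * y"
      and u: "\<And>c'. z = diag (fst c') * x + diag (snd c') * y \<Longrightarrow> c' = c"
      using basis by metis
    show "\<exists>!c. z = diag (fst c) * y + diag (snd c) * x"
    proof (rule ex1I[of _ "(snd c, fst c)"])
      show "z = diag (fst (snd c, fst c)) * y + diag (snd (snd c, fst c)) * x"
        using c by (simp add: add.commute)
      fix c' assume "z = diag (fst c') * y + diag (snd c') * x"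
      then show "c' = (snd c, fst c)"
        using u[of "(snd c', fst c')"] by (auto simp: add.commute prod_eq_iff)
    qed
  qed
  have "fst x \<noteq> 0 \<or> fst y \<noteq> 0"
  proof (rule ccontr)
    assume "\<not> ?thesis"
    moreover obtain c where "(1, 0) = diag (fst c) * x + diag (snd c) * y" using basis by metis
    ultimately show False by (auto simp: prod_eq_iff diag_def)
  qed
  then consider "fst x \<noteq> 0" "fst y = 0 \<or> v (fst x) \<le> v (fst y)"
    | "fst y \<noteq> 0" "fst x = 0 \<or> v (fst y) \<le> v (fst x)" by linarith
  then have "\<exists>k b N. ?S x y = lat k b N"
  proof cases
    case 1 then show ?thesis using basis_lattice_eq_lat[OF basis] by blast
  next
    case 2 then show ?thesis unfolding swap using basis_lattice_eq_lat[OF basis'] by blast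
  qed
  then show ?thesis using that X hclass_lat_ball by metis
qed


subsection \<open>Orders and their units\<close>

text \<open>The order consists of the integral pairs whose coordinates agree modulo
  \<open>p ^ k\<close>. Such pairs form a ring containing the generator; conversely, polynomials of
  degree at most one in the generator already give all of them.\<close>

lemma L_order_eq_lat: "L_order v p k = lat 0 1 (int k)"
proof (rule set_eqI, rule iffI)
  fix z assume "z \<in> L_order v p k"
  then obtain N c where z: "z = (\<Sum>i\<le>N. diag (c i) * (diag (p ^ k) * Delta p) ^ i)"
    and c: "\<forall>i\<le>N. ge 0 (c i)"
    by (auto simp: L_order_def adjoin_def)
  have mult: "x * y \<in> lat 0 1 (int k)" if "x \<in> lat 0 1 (int k)" "y \<in> lat 0 1 (int k)" for x y
  proof -
    have x: "ge 0 (fst x)" "ge k (snd x - fst x)" and y: "ge 0 (fst y)" "ge k (snd y - fst y)"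
      using that by (auto simp: lat_def)
    have "ge 0 ((snd x - fst x) + fst x)" using x by (intro ge_add) (auto elim: ge_mono)
    then have "ge k (snd x * (snd y - fst y) + fst y * (snd x - fst x))"
      using x y ge_mult[of 0 "snd x" k "snd y - fst y"] ge_mult[of 0 "fst y" k "snd x - fst x"]
      by (intro ge_add) auto
    then show ?thesis using x y ge_mult[of 0 "fst x" 0 "fst y"]
      by (simp add: lat_def times_prod_def algebra_simps)
  qed
  have gen: "diag (p ^ k) * Delta p \<in> lat 0 1 (int k)"
  proof -
    have "p ^ k * p - p ^ k = p ^ k * (p - 1)" by (simp add: algebra_simps)
    moreover have "ge 0 (p - 1)" by (rule ge_diff) (simp_all add: val_ge_def)
    ultimately show ?thesis
      by (simp add: lat_def diag_def Delta_def times_prod_def ge_mult_left_iff) (simp add: val_ge_def)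
  qed
  have pow: "(diag (p ^ k) * Delta p) ^ i \<in> lat 0 1 (int k)" for i
  proof (induction i)
    case 0 show ?case by (simp add: lat_def one_prod_def)
  next
    case (Suc i) then show ?case using mult[OF gen Suc] by simp
  qed
  have "(\<Sum>i\<le>M. diag (c i) * (diag (p ^ k) * Delta p) ^ i) \<in> lat 0 1 (int k)" if "M \<le> N" for M
    using that
  proof (induction M)
    have term_in: "diag (c i) * (diag (p ^ k) * Delta p) ^ i \<in> lat 0 1 (int k)" if "i \<le> N" for i
      using c that by (intro mult pow) (simp add: lat_def diag_def)
    {
      case 0 show ?case using term_in[of 0] by simp
    next
      case (Suc M)
      have add: "x + y \<in> lat 0 1 (int k)" if "x \<in> lat 0 1 (int k)" "y \<in> lat 0 1 (int k)" for x y
        using that ge_add[of 0 "fst x" "fst y"] ge_add[of k "snd x - fst x" "snd y - fst y"]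
        by (auto simp: lat_def algebra_simps)
      show ?case using Suc add term_in[of "Suc M"] by (simp del: power_Suc)
    }
  qed
  then show "z \<in> lat 0 1 (int k)" using z by simp
next
  fix z assume "z \<in> lat 0 1 (int k)"
  then have z: "ge 0 (fst z)" "ge k (snd z - fst z)" by (auto simp: lat_def)
  \<comment> \<open>The generator has coordinates \<open>p ^ k\<close> and \<open>p ^ k * p\<close>,
    so the difference of the coordinates of \<open>z\<close> determines its coefficient;
    \<open>p - 1\<close> is a unit, being congruent to \<open>- 1\<close>.\<close>
  define b where "b = (snd z - fst z) / (p ^ k * (p - 1))"
  define a where "a = fst z - b * p ^ k"
  have p1: "p - 1 \<noteq> 0" "v (p - 1) = 0"
    using val_eqI[of 1 "p - 1" "- 1"] by (simp_all add: val_ge_def)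
  then have b: "ge 0 b"
    using z by (simp add: b_def ge_divide_iff val_mult)
  moreover have "ge 0 a"
    unfolding a_def using z ge_mult[OF b, of "int k" "p ^ k"]
    by (intro ge_diff) (auto elim!: ge_mono simp: val_ge_def)
  moreover have "z = diag a + diag b * (diag (p ^ k) * Delta p)"
  proof -
    have "b * (p ^ k * (p - 1)) = snd z - fst z" using p1 by (simp add: b_def)
    then show ?thesis by (simp add: prod_eq_iff diag_def Delta_def a_def algebra_simps)
  qed
  ultimately show "z \<in> L_order v p k"
    unfolding L_order_def adjoin_def mem_Collect_eq
    by (intro exI[of _ 1] exI[of _ "\<lambda>i. if i = 0 then a else b"]) auto
qed

text \<open>A congruence modulo \<open>p ^ k\<close> between two units of the integers passes to
  their inverses, so the coordinatewise inverse stays in the order.\<close>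

lemma L_order_units_iff:
  "z \<in> L_order_units v p k \<longleftrightarrow>
     fst z \<noteq> 0 \<and> snd z \<noteq> 0 \<and> v (fst z) = 0 \<and> v (snd z) = 0 \<and> ge k (snd z - fst z)"
proof
  assume "z \<in> L_order_units v p k"
  then obtain w where zw: "z \<in> lat 0 1 k" "w \<in> lat 0 1 k" "z * w = 1"
    by (auto simp: L_order_units_def L_order_eq_lat)
  then have o: "fst z * fst w = 1" "snd z * snd w = 1" by (simp_all add: prod_eq_iff)
  have snd_int: "ge 0 (snd x)" if "x \<in> lat 0 1 k" for x
    using that ge_add[OF ge_mono[of k "snd x - fst x" 0], of "fst x"] by (auto simp: lat_def)
  have unit: "a \<noteq> 0 \<and> v a = 0" if "a * b = 1" "ge 0 a" "ge 0 b" for a b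
  proof -
    have "a \<noteq> 0" "b \<noteq> 0" using that(1) by auto
    then show ?thesis using that val_mult[of a b] by (auto simp: val_ge_def)
  qed
  have "fst z \<noteq> 0 \<and> v (fst z) = 0" using o(1) zw by (intro unit) (auto simp: lat_def)
  moreover have "snd z \<noteq> 0 \<and> v (snd z) = 0" using o(2) zw(1,2) by (intro unit[of _ "snd w"] snd_int)
  ultimately show "fst z \<noteq> 0 \<and> snd z \<noteq> 0 \<and> v (fst z) = 0 \<and> v (snd z) = 0 \<and> ge k (snd z - fst z)"
    using zw by (auto simp: lat_def)
next
  assume z: "fst z \<noteq> 0 \<and> snd z \<noteq> 0 \<and> v (fst z) = 0 \<and> v (snd z) = 0 \<and> ge k (snd z - fst z)"
  have "1 / snd z - 1 / fst z = (fst z - snd z) / (fst z * snd z)"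
    using z by (simp add: field_simps)
  then have "ge k (1 / snd z - 1 / fst z)"
    using z ge_commute[of k "fst z" "snd z"] by (simp add: ge_divide_iff val_mult)
  then have "(1 / fst z, 1 / snd z) \<in> lat 0 1 k"
    using z by (simp add: lat_def ge_divide_iff)
  moreover have "z \<in> lat 0 1 k" using z by (simp add: lat_def case_prod_beta val_ge_def[of v 0])
  moreover have "z * (1 / fst z, 1 / snd z) = 1" using z by (simp add: prod_eq_iff)
  ultimately show "z \<in> L_order_units v p k"
    unfolding L_order_units_def L_order_eq_lat by blast
qed

lemma hclass_L_order: "hclass (L_order v p k) = ball_vertex 1 (int k)"
  by (simp add: L_order_eq_lat ball_vertex_def)

lemma hclass_times_L_order:
  assumes "fst z \<noteq> 0" "snd z \<noteq> 0"
  shows "hclass (z *o L_order v p k) =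
    ball_vertex (snd z / fst z) (int k + v (snd z) - v (fst z))"
  using times_lat[OF assms, of 0 1 "int k"] by (simp add: L_order_eq_lat hclass_lat_ball)

lemma hclass_tilde_order: "hclass (tilde_order v p m) = ball_vertex 0 m"
proof -
  have "tilde_order v p m = lat 0 0 m"
  proof (rule set_eqI, rule iffI)
    fix z assume "z \<in> tilde_order v p m"
    then obtain a b where "z = (1, 0) * diag a + (0, p powi m) * diag b" "ge 0 a" "ge 0 b"
      by (auto simp: tilde_order_def)
    then show "z \<in> lat 0 0 m"
      by (simp add: lat_def diag_def times_prod_def ge_mult_left_iff)
  next
    fix z assume "z \<in> lat 0 0 m"
    then have "ge 0 (fst z)" "ge 0 (snd z / p powi m)" by (auto simp: lat_def ge_divide_iff)
    moreover have "z = (1, 0) * diag (fst z) + (0, p powi m) * diag (snd z / p powi m)"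
      by (simp add: prod_eq_iff diag_def)
    ultimately show "z \<in> tilde_order v p m" unfolding tilde_order_def by force
  qed
  then show ?thesis by (simp add: ball_vertex_def)
qed

subsection \<open>Distances\<close>

text \<open>Any centre of the smaller ball is also a centre of the larger one, so adjacent balls can
  be written concentrically.\<close>

lemma adj_cases:
  assumes "X \<in> bt_vertices v" "Y \<in> bt_vertices v" "bt_adj p X Y"
  obtains b N where "X = ball_vertex b N" "Y = ball_vertex b (N + 1)"
    | b N where "X = ball_vertex b (N + 1)" "Y = ball_vertex b N"
proof -
  obtain b N b' N' where XY: "X = ball_vertex b N" "Y = ball_vertex b' N'"
    using assms(1,2) vertex_ball by metis
  then consider "N' = N + 1" "ge N (b - b')" | "N = N' + 1" "ge N' (b - b')"
    using assms(3) by (auto simp: adj_ball_iff)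
  then show ?thesis
  proof cases
    case 1
    then have "X = ball_vertex b' N" by (simp add: XY ball_vertex_eq_iff)
    then show ?thesis using that(1) XY 1 by blast
  next
    case 2
    then have "Y = ball_vertex b N'" by (simp add: XY ball_vertex_eq_iff ge_commute)
    then show ?thesis using that(2) XY 2 by blast
  qed
qed

text \<open>Unlike the centre, the exponent of a ball is determined by the vertex. Changing by one
  along each edge, it serves as a lower bound for distances.\<close>

definition height :: "('a \<times> 'a) set set \<Rightarrow> int" where
  "height X = (THE N. \<exists>b. X = ball_vertex b N)"

lemma height_ball [simp]: "height (ball_vertex b N) = N"
  unfolding height_def by (rule the_equality) (blast, auto simp: ball_vertex_eq_iff)

text \<open>The distance from the apartment, cf. \<open>apartment_dist_eq\<close>.\<close>

definition level :: "('a \<times> 'a) set set \<Rightarrow> int" where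
  "level X = (THE l. \<exists>b N. X = ball_vertex b N \<and> l = (if ge N b then 0 else N - v b))"

text \<open>Moving the centre within the ball changes neither whether the ball contains 0 nor, if it
  does not, the valuation of the centre (\<open>val_eqI\<close>).\<close>

lemma level_ball [simp]: "level (ball_vertex b N) = (if ge N b then 0 else N - v b)"
  unfolding level_def
proof (rule the_equality)
  fix l assume "\<exists>b' N'. ball_vertex b N = ball_vertex b' N' \<and> l = (if ge N' b' then 0 else N' - v b')"
  then obtain b' where b': "ge N (b - b')" "l = (if ge N b' then 0 else N - v b')"
    by (auto simp: ball_vertex_eq_iff)
  show "l = (if ge N b then 0 else N - v b)"
  proof (cases "ge N b'")
    case True
    then show ?thesis using b' ge_add[of N "b - b'" b'] by simp
  next
    case False
    then have "b' \<noteq> 0" "v b' < N" by (auto simp: val_ge_def)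
    then show ?thesis using b' val_eqI[of N b b'] by (auto simp: val_ge_def)
  qed
qed auto

text \<open>Each edge lowers \<open>f\<close> by at most one. For \<open>W\<close> the end of the
  walk this bounds distances from below; for an inner \<open>W\<close> it shows which vertices a
  short walk cannot meet.\<close>

lemma walk_lipschitz:
  fixes f :: "('a \<times> 'a) set set \<Rightarrow> int"
  assumes f: "\<And>X Y. X \<in> bt_vertices v \<Longrightarrow> Y \<in> bt_vertices v \<Longrightarrow> bt_adj p X Y \<Longrightarrow> f X \<le> f Y + 1"
  shows "bt_walk v p X xs Y \<Longrightarrow> W \<in> set xs \<Longrightarrow> f X \<le> f W + int (length xs - 1)"
proof (induction xs arbitrary: X)
  case (Cons x xs)
  show ?case
  proof (cases "W = X \<or> xs = []")
    case True
    then show ?thesis using Cons.prems by (auto simp: bt_walk_def)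
  next
    case False
    then have w: "bt_walk v p (hd xs) xs Y" "W \<in> set xs" "X = x"
      using Cons.prems by (auto simp: bt_walk_def successively_Cons)
    have "set (x # xs) \<subseteq> bt_vertices v" "bt_adj p x (hd xs)"
      using Cons.prems False by (auto simp: bt_walk_def successively_Cons)
    then have "f X \<le> f (hd xs) + 1"
      using w(3) hd_in_set[of xs] False by (intro f) (simp_all add: subset_iff)
    then show ?thesis using Cons.IH[OF w(1,2)] False by (cases xs) auto
  qed
qed (simp add: bt_walk_def)

lemma height_adj:
  "X \<in> bt_vertices v \<Longrightarrow> Y \<in> bt_vertices v \<Longrightarrow> bt_adj p X Y \<Longrightarrow> height X \<le> height Y + 1"
  by (erule (2) adj_cases) simp_all

lemma level_adj:
  "X \<in> bt_vertices v \<Longrightarrow> Y \<in> bt_vertices v \<Longrightarrow> bt_adj p X Y \<Longrightarrow> level X \<le> level Y + 1"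
  by (erule (2) adj_cases) (auto simp: val_ge_def)

lemma walk_end: "bt_walk v p X xs Y \<Longrightarrow> Y \<in> set xs"
  by (auto simp: bt_walk_def)

lemma bt_dist_lower:
  fixes f :: "('a \<times> 'a) set set \<Rightarrow> int"
  assumes "\<And>X Y. X \<in> bt_vertices v \<Longrightarrow> Y \<in> bt_vertices v \<Longrightarrow> bt_adj p X Y \<Longrightarrow> f X \<le> f Y + 1"
  shows "enat (nat (f X - f Y)) \<le> bt_dist v p X Y"
  unfolding bt_dist_def
proof (rule INF_greatest)
  fix xs assume "xs \<in> {xs. bt_walk v p X xs Y}"
  then have "f X \<le> f Y + int (length xs - 1)"
    using walk_lipschitz[of f X xs Y Y, OF assms] walk_end by blast
  then show "enat (nat (f X - f Y)) \<le> enat (length xs - 1)" by simp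
qed

text \<open>The walk passes through the concentric balls whose exponents decrease one by
  one.\<close>

lemma bt_dist_ball_le: "bt_dist v p (ball_vertex b (N + int d)) (ball_vertex b N) \<le> enat d"
proof -
  have "\<exists>xs. bt_walk v p (ball_vertex b (N + int d)) xs (ball_vertex b N) \<and> length xs = d + 1"
  proof (induction d)
    case 0
    show ?case by (rule exI[of _ "[ball_vertex b N]"]) (simp add: bt_walk_def)
  next
    case (Suc d)
    then obtain xs where "bt_walk v p (ball_vertex b (N + int d)) xs (ball_vertex b N)"
      "length xs = d + 1" by blast
    then show ?case
      by (intro exI[of _ "ball_vertex b (N + int (Suc d)) # xs"])
        (auto simp: bt_walk_def successively_Cons adj_ball_iff)
  qed
  then obtain xs where "bt_walk v p (ball_vertex b (N + int d)) xs (ball_vertex b N)"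
    "length xs = d + 1" by blast
  then show ?thesis unfolding bt_dist_def
    by (intro INF_lower2[of xs]) auto
qed

lemma bt_dist_ball: "bt_dist v p (ball_vertex b (N + int d)) (ball_vertex b N) = enat d"
  using bt_dist_ball_le bt_dist_lower[of height "ball_vertex b (N + int d)" "ball_vertex b N"]
    height_adj by (intro antisym) auto

lemma apartment_dist_eq:
  assumes "X \<in> bt_vertices v"
  shows "apartment_dist v p X = enat (nat (level X))"
proof (rule antisym)
  obtain b N where X: "X = ball_vertex b N" using assms vertex_ball by blast
  define l where "l = nat (level X)"
  \<comment> \<open>Enlarging the ball \<open>l\<close> times makes it contain 0, hence an apartment
    vertex. The opposite bound holds since \<open>level\<close> vanishes on the apartment.\<close>
  have l: "ge (N - int l) b" by (auto simp: l_def X) (auto simp: val_ge_def)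
  then have "ball_vertex b (N - int l) = ball_vertex 0 (N - int l)"
    by (simp add: ball_vertex_eq_iff)
  then have "bt_dist v p X (ball_vertex 0 (N - int l)) \<le> enat l"
    using bt_dist_ball_le[of b "N - int l" l] by (simp add: X)
  then show "apartment_dist v p X \<le> enat (nat (level X))"
    unfolding apartment_dist_def hclass_tilde_order l_def[symmetric]
    by (intro INF_lower2[of "N - int l"]) auto
  show "enat (nat (level X)) \<le> apartment_dist v p X"
    unfolding apartment_dist_def hclass_tilde_order
  proof (rule INF_greatest)
    fix m show "enat (nat (level X)) \<le> bt_dist v p X (ball_vertex 0 m)"
      using bt_dist_lower[of level X "ball_vertex 0 m"] level_adj by simp
  qed
qed

lemma vertices_at_apartment_dist:
  assumes "n \<ge> 1"
  shows "{X \<in> bt_vertices v. apartment_dist v p X = enat n} =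
    {ball_vertex b (int n + v b) | b. b \<noteq> 0}" (is "?A = ?B")
proof (rule set_eqI, rule iffI)
  fix X assume X: "X \<in> ?A"
  then obtain b N where b: "X = ball_vertex b N" using vertex_ball by blast
  have "nat (level X) = n" using X apartment_dist_eq[of X] by simp
  then have "\<not> ge N b" "N = int n + v b" using assms by (auto simp: b split: if_splits)
  moreover from this have "b \<noteq> 0" by auto
  ultimately show "X \<in> ?B" using b by blast
next
  fix X assume "X \<in> ?B"
  then obtain b where b: "X = ball_vertex b (int n + v b)" "b \<noteq> 0" by blast
  then have "level X = int n" using assms by (simp add: val_ge_def)
  then show "X \<in> ?A" using apartment_dist_eq[of X] b by simp
qed

text \<open>A ball has a unique neighbour containing it, so a walk that reaches \<open>c + p\<^sup>k\<O>\<close>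
  without meeting \<open>c + p\<^bsup>k-1\<^esup>\<O>\<close> stays inside \<open>c + p\<^sup>k\<O>\<close>.\<close>

lemma walk_avoiding_parent:
  assumes "bt_walk v p X xs (ball_vertex c k)" "ball_vertex c (k - 1) \<notin> set xs"
  shows "\<exists>b N. X = ball_vertex b N \<and> k \<le> N \<and> ge k (b - c)"
  using assms
proof (induction xs arbitrary: X)
  case (Cons x xs)
  show ?case
  proof (cases "xs = []")
    case True
    then have "X = ball_vertex c k" using Cons.prems by (auto simp: bt_walk_def)
    then show ?thesis by (intro exI[of _ c] exI[of _ k]) simp
  next
    case False
    then have "bt_walk v p (hd xs) xs (ball_vertex c k)" and X: "X = x"
      using Cons.prems by (auto simp: bt_walk_def successively_Cons)
    then obtain b' N' where Y: "hd xs = ball_vertex b' N'" "k \<le> N'" "ge k (b' - c)"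
      using Cons.IH Cons.prems(2) by (metis list.set_intros(2))
    have "set (x # xs) \<subseteq> bt_vertices v" "bt_adj p X (hd xs)"
      using Cons.prems False by (auto simp: bt_walk_def successively_Cons)
    then have "X \<in> bt_vertices v" "hd xs \<in> bt_vertices v" "bt_adj p X (hd xs)"
      using X hd_in_set[OF False] by auto
    then show ?thesis
    \<comment> \<open>Either \<open>X\<close> is the parent of the next vertex, and then it leaves
      the ball around \<open>c\<close> only if it is the forbidden vertex, or \<open>X\<close> lies
      inside the next ball.\<close>
    proof (cases rule: adj_cases)
      case (1 b N)
      then have N: "N' = N + 1" "ge N' (b - b')" using Y
        by (auto simp: ball_vertex_eq_iff ge_commute)
      then have bc: "ge k (b - c)" using Y by (meson ge_mono ge_trans)
      have "N \<noteq> k - 1"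
      proof
        assume "N = k - 1"
        then have "X = ball_vertex c (k - 1)"
          using 1(1) ge_mono[OF bc, of "k - 1"] by (simp add: ball_vertex_eq_iff)
        then show False using Cons.prems(2) X by auto
      qed
      then have "k \<le> N" using N Y by linarith
      then show ?thesis using 1 bc by blast
    next
      case (2 b N)
      then have N: "N' = N" "ge N' (b - b')" using Y
        by (auto simp: ball_vertex_eq_iff ge_commute)
      then have "ge k (b - c)" using Y by (meson ge_mono ge_trans)
      moreover have "k \<le> N + 1" using N Y by linarith
      ultimately show ?thesis using 2 by blast
    qed
  qed
qed (simp add: bt_walk_def)

lemma vertices_beyond_ball:
  "{X \<in> bt_vertices v. bt_dist v p X (ball_vertex c k) = enat d \<and>
      (\<forall>xs. bt_geodesic v p X xs (ball_vertex c k) \<longrightarrow> ball_vertex c (k - 1) \<notin> set xs)} =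
   {ball_vertex b (k + int d) | b. ge k (b - c)}" (is "?A = ?B")
proof (rule set_eqI, rule iffI)
  fix X assume X: "X \<in> ?A"
  \<comment> \<open>An empty infimum is infinite. As the distance is finite, it is attained, so a
    geodesic exists to which the avoidance condition applies.\<close>
  have "{xs. bt_walk v p X xs (ball_vertex c k)} \<noteq> {}"
  proof
    assume "{xs. bt_walk v p X xs (ball_vertex c k)} = {}"
    then have "bt_dist v p X (ball_vertex c k) = \<infinity>" by (simp add: bt_dist_def top_enat_def)
    then show False using X by simp
  qed
  then have "bt_dist v p X (ball_vertex c k) \<in>
      (\<lambda>xs. enat (length xs - 1)) ` {xs. bt_walk v p X xs (ball_vertex c k)}"
    unfolding bt_dist_def by (metis image_is_empty wellorder_InfI ex_in_conv)
  then obtain xs where xs: "bt_geodesic v p X xs (ball_vertex c k)"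
    by (auto simp: bt_geodesic_def)
  then obtain b N where b: "X = ball_vertex b N" "k \<le> N" "ge k (b - c)"
    using X walk_avoiding_parent unfolding bt_geodesic_def by blast
  have "ball_vertex c k = ball_vertex b k" using b by (simp add: ball_vertex_eq_iff ge_commute)
  then have "enat d = enat (nat (N - k))"
    using X bt_dist_ball[of b k "nat (N - k)"] b by simp
  then have "N = k + int d" using b by simp
  then show "X \<in> ?B" using b by blast
next
  fix X assume "X \<in> ?B"
  then obtain b where b: "X = ball_vertex b (k + int d)" "ge k (b - c)" by blast
  have "ball_vertex c k = ball_vertex b k" using b by (simp add: ball_vertex_eq_iff ge_commute)
  then have dist: "bt_dist v p X (ball_vertex c k) = enat d"
    using bt_dist_ball b by simp
  \<comment> \<open>Descending from height \<open>k + int d\<close> to \<open>k - 1\<close> takes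
    more than the \<open>d\<close> steps of a geodesic.\<close>
  moreover have "ball_vertex c (k - 1) \<notin> set xs" if "bt_geodesic v p X xs (ball_vertex c k)" for xs
  proof
    assume "ball_vertex c (k - 1) \<in> set xs"
    moreover have "bt_walk v p X xs (ball_vertex c k)" "length xs - 1 = d"
      using that dist by (auto simp: bt_geodesic_def)
    ultimately have "height X \<le> height (ball_vertex c (k - 1)) + int d"
      using walk_lipschitz[of height X xs] height_adj by metis
    then show False using b by simp
  qed
  ultimately show "X \<in> ?A" using b by simp
qed

subsection \<open>Digits of ratios\<close>

text \<open>When both coordinates of \<open>z\<close> are units, \<open>hclass_times_L_order\<close>
  identifies the class of \<open>z *o L_order v p n\<close> with the ball of exponent
  \<open>n\<close> around this ratio.\<close>

definition ratio :: "'a \<times> 'a \<Rightarrow> 'a" where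
  "ratio z = snd z / fst z"

lemma ratio_mult: "ratio (x * y) = ratio x * ratio y"
  by (simp add: ratio_def)

lemma ratio_prod: "ratio (prod f A) = (\<Prod>i\<in>A. ratio (f i))"
  by (induction A rule: infinite_finite_induct) (simp_all add: ratio_mult, simp_all add: ratio_def)

lemma fst_prod: "fst (prod f A) = (\<Prod>i\<in>A. fst (f i))"
  and snd_prod: "snd (prod f A) = (\<Prod>i\<in>A. snd (f i))"
  by (induction A rule: infinite_finite_induct) simp_all

lemma one_units_mult:
  assumes "k \<ge> 0" "ge k (x - 1)" "ge k (y - 1)"
  shows "ge k (x * y - 1)"
proof -
  have "ge k ((x - 1) * (y - 1) + (x - 1) + (y - 1))"
    using assms ge_mono[OF ge_mult[OF assms(2,3)], of k] by (intro ge_add) auto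
  then show ?thesis by (simp add: algebra_simps)
qed

lemma one_units_prod:
  assumes "k \<ge> 0" "\<And>i. i \<in> A \<Longrightarrow> ge k (f i - 1)"
  shows "ge k (prod f A - 1)"
  using assms(2)
  by (induction A rule: infinite_finite_induct) (auto intro: one_units_mult assms(1))

lemma u_elem_one_units:
  assumes "i \<ge> 1" "ge 0 t"
  shows "ge (int i) (fst (u_elem p i t) - 1)" "ge (int i) (snd (u_elem p i t) - 1)"
proof -
  have "ge (int i) (p ^ i * t)" "ge (int i) (p ^ i * (p * t))"
    using assms ge_mono[of 0 t "-1"] by (simp_all add: ge_mult_left_iff)
  then show "ge (int i) (fst (u_elem p i t) - 1)" "ge (int i) (snd (u_elem p i t) - 1)"
    by (simp_all add: u_elem_def Delta_def diag_def mult_ac)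
qed

lemma u_elem_units:
  assumes "i \<ge> 1" "ge 0 t"
  shows "fst (u_elem p i t) \<noteq> 0 \<and> v (fst (u_elem p i t)) = 0"
    "snd (u_elem p i t) \<noteq> 0 \<and> v (snd (u_elem p i t)) = 0"
  using u_elem_one_units[OF assms] assms(1) by (auto intro!: one_unit elim: ge_mono)

text \<open>Multiplication by \<open>u_elem p i t\<close> changes the ratio by \<open>1 - t p\<^sup>i\<close> modulo \<open>p\<^bsup>i+1\<^esup>\<close>:
  the parameter is, up to sign, the \<open>i\<close>-th \<open>p\<close>-adic digit of the ratio.\<close>

lemma ratio_u_elem:
  assumes "i \<ge> 1" "ge 0 t"
  shows "ge (int i + 1) (ratio (u_elem p i t) - 1 + t * p ^ i)"
proof -
  let ?f = "1 + t * p ^ i"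
  have f: "?f \<noteq> 0" "v ?f = 0"
    using u_elem_units(1)[OF assms] by (simp_all add: u_elem_def Delta_def diag_def)
  have "ratio (u_elem p i t) = (1 + t * p ^ i * p) / ?f"
    by (simp add: ratio_def u_elem_def Delta_def diag_def)
  also have "\<dots> - 1 + t * p ^ i = (t * p ^ i) * (p + t * p ^ i) / ?f"
    using f(1) by (simp add: field_simps)
  finally have eq: "ratio (u_elem p i t) - 1 + t * p ^ i = (t * p ^ i) * (p + t * p ^ i) / ?f" .
  have "ge (int i) (t * p ^ i)" using ge_mult[OF assms(2), of "int i" "p ^ i"]
    by (simp add: val_ge_def)
  moreover from this have "ge 1 (p + t * p ^ i)"
    using assms(1) by (intro ge_add) (auto elim: ge_mono simp: val_ge_def[of v 1 p])
  ultimately show ?thesis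
    unfolding eq using f ge_mult by (simp add: ge_divide_iff)
qed

lemma ratio_u_elem_one_unit:
  assumes "i \<ge> 1" "ge 0 t"
  shows "ge (int i) (ratio (u_elem p i t) - 1)"
proof -
  have "ge (int i) (t * p ^ i)" using ge_mult[OF assms(2), of "int i" "p ^ i"]
    by (simp add: val_ge_def)
  from ge_diff[OF ge_mono[OF ratio_u_elem[OF assms], of "int i"] this] show ?thesis by simp
qed

section \<open>Solving for the digits modulo powers of \<open>p\<close>\<close>

lemma residue_repsD:
  assumes "residue_reps v p R"
  shows "t \<in> R \<Longrightarrow> ge 0 t" "ge 0 x \<Longrightarrow> \<exists>!t. t \<in> R \<and> ge 1 (x - t)"
proof -
  have mem: "y \<in> p *o int_ring v \<longleftrightarrow> ge 1 y" for y
  proof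
    assume "y \<in> p *o int_ring v"
    then show "ge 1 y" by (auto simp: elt_set_times_def ge_mult_left_iff)
  next
    assume "ge 1 y"
    then show "y \<in> p *o int_ring v"
      by (auto simp: elt_set_times_def ge_divide_iff intro!: bexI[of _ "y / p"])
  qed
  show "t \<in> R \<Longrightarrow> ge 0 t" using assms by (auto simp: residue_reps_def)
  show "ge 0 x \<Longrightarrow> \<exists>!t. t \<in> R \<and> ge 1 (x - t)"
    using assms by (simp add: residue_reps_def mem)
qed

abbreviation digits_ratio :: "nat \<Rightarrow> nat \<Rightarrow> (nat \<Rightarrow> 'a) \<Rightarrow> 'a" where
  "digits_ratio k n \<alpha> \<equiv> (\<Prod>i\<in>{k..<n}. ratio (u_elem p i (\<alpha> i)))"

lemma digits_ratio_one_unit: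
  assumes "residue_reps v p R" "k \<ge> 1" "\<alpha> \<in> {k..<n} \<rightarrow>\<^sub>E R"
  shows "ge (int k) (digits_ratio k n \<alpha> - 1)"
proof (rule one_units_prod)
  fix i assume i: "i \<in> {k..<n}"
  then have "ge 0 (\<alpha> i)" using assms residue_repsD(1) by (auto dest: PiE_mem)
  then show "ge (int k) (ratio (u_elem p i (\<alpha> i)) - 1)"
    using i assms(2) ge_mono[OF ratio_u_elem_one_unit, of i "\<alpha> i" "int k"] by auto
qed simp

text \<open>As \<open>q\<close> is 1 modulo \<open>p\<close>, multiplying it by the ratio amounts to
  subtracting \<open>t * p ^ i\<close> modulo \<open>p ^ (i + 1)\<close>. The multiplicative
  condition becomes linear in the digit \<open>t\<close>.\<close>

lemma digits_step:
  assumes "ge 1 (q - 1)" "i \<ge> 1" "ge 0 t"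
  shows "ge (int i + 1) (q * ratio (u_elem p i t) - r) \<longleftrightarrow> ge (int i + 1) (q - r - t * p ^ i)"
proof -
  have q: "ge 0 q" using one_unit[OF assms(1)] by (simp add: val_ge_def)
  have "ge (int i) (t * p ^ i)" using ge_mult[OF assms(3), of "int i" "p ^ i"]
    by (simp add: val_ge_def)
  from ge_mult[OF assms(1) this] have "ge (int i + 1) ((q - 1) * (t * p ^ i))"
    by (simp add: add.commute)
  then have "ge (int i + 1) (q * (ratio (u_elem p i t) - 1 + t * p ^ i) - (q - 1) * (t * p ^ i))"
    using ge_mult[OF q ratio_u_elem[OF assms(2,3)]] by (intro ge_diff) auto
  moreover have "q * (ratio (u_elem p i t) - 1 + t * p ^ i) - (q - 1) * (t * p ^ i) =
      (q * ratio (u_elem p i t) - r) - (q - r - t * p ^ i)"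
    by (simp add: algebra_simps)
  ultimately have d: "ge (int i + 1) ((q * ratio (u_elem p i t) - r) - (q - r - t * p ^ i))"
    by simp
  show ?thesis
  proof
    assume "ge (int i + 1) (q * ratio (u_elem p i t) - r)"
    from ge_diff[OF this d] show "ge (int i + 1) (q - r - t * p ^ i)"
      by (simp add: algebra_simps)
  next
    assume "ge (int i + 1) (q - r - t * p ^ i)"
    from ge_add[OF d this] show "ge (int i + 1) (q * ratio (u_elem p i t) - r)" by simp
  qed
qed

text \<open>Successive approximation: the digits below \<open>n\<close> are fixed by the congruence
  modulo \<open>p ^ n\<close>, and then the digit at \<open>n\<close> must represent the residue of
  \<open>(q - r) / p ^ n\<close>, where \<open>q\<close> is the product so far.\<close>

lemma digits_ratio_ex1:
  assumes R: "residue_reps v p R" and k: "1 \<le> k" "k \<le> n" and r: "ge (int k) (r - 1)"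
  shows "\<exists>!\<alpha>. \<alpha> \<in> {k..<n} \<rightarrow>\<^sub>E R \<and> ge (int n) (digits_ratio k n \<alpha> - r)"
  using k(2)
proof (induction n rule: dec_induct)
  case base
  then show ?case using r by (auto simp: ge_commute)
next
  case (step n)
  have n: "n \<ge> 1" using step.hyps k by simp
  have split: "digits_ratio k (Suc n) \<alpha> = digits_ratio k n \<alpha> * ratio (u_elem p n (\<alpha> n))" for \<alpha>
    using step.hyps by (simp add: atLeastLessThanSuc mult.commute)
  obtain \<alpha> where \<alpha>: "\<alpha> \<in> {k..<n} \<rightarrow>\<^sub>E R" "ge (int n) (digits_ratio k n \<alpha> - r)"
    and \<alpha>_uniq: "\<And>\<beta>. \<beta> \<in> {k..<n} \<rightarrow>\<^sub>E R \<Longrightarrow> ge (int n) (digits_ratio k n \<beta> - r) \<Longrightarrow> \<beta> = \<alpha>"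
    using step.IH by (elim ex1E) blast
  define q where "q = digits_ratio k n \<alpha>"
  have q: "ge 1 (q - 1)"
    using ge_mono[OF digits_ratio_one_unit[OF R k(1) \<alpha>(1)], of 1] k(1) by (simp add: q_def)
  have last: "ge (int n + 1) (q * ratio (u_elem p n t) - r) \<longleftrightarrow> ge 1 ((q - r) / p ^ n - t)"
    if "t \<in> R" for t
  proof -
    have "(q - r) / p ^ n - t = (q - r - t * p ^ n) / p ^ n" by (simp add: field_simps)
    then have "ge 1 ((q - r) / p ^ n - t) \<longleftrightarrow> ge (int n + 1) (q - r - t * p ^ n)"
      by (simp add: ge_divide_iff add.commute)
    then show ?thesis using digits_step[OF q n residue_repsD(1)[OF R that]] by simp
  qed
  have "ge 0 ((q - r) / p ^ n)" using \<alpha>(2) by (simp add: ge_divide_iff q_def)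
  then obtain t where t: "t \<in> R" "ge 1 ((q - r) / p ^ n - t)"
    and t_uniq: "\<And>s. s \<in> R \<Longrightarrow> ge 1 ((q - r) / p ^ n - s) \<Longrightarrow> s = t"
    using residue_repsD(2)[OF R] by (metis (no_types, lifting))
  show ?case
  proof (rule ex1I[of _ "\<alpha>(n := t)"], intro conjI)
    show "\<alpha>(n := t) \<in> {k..<Suc n} \<rightarrow>\<^sub>E R"
      using \<alpha>(1) t(1) step.hyps by (auto simp: PiE_iff extensional_def)
    have "digits_ratio k n (\<alpha>(n := t)) = q" unfolding q_def by (rule prod.cong) auto
    then show "ge (int (Suc n)) (digits_ratio k (Suc n) (\<alpha>(n := t)) - r)"
      unfolding split using last[OF t(1)] t(2) by (simp add: add.commute)
  next
    fix \<beta> assume \<beta>: "\<beta> \<in> {k..<Suc n} \<rightarrow>\<^sub>E R \<and> ge (int (Suc n)) (digits_ratio k (Suc n) \<beta> - r)"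
    define \<gamma> where "\<gamma> = restrict \<beta> {k..<n}"
    have \<gamma>: "\<gamma> \<in> {k..<n} \<rightarrow>\<^sub>E R" using \<beta> by (auto simp: \<gamma>_def PiE_iff)
    have \<beta>n: "\<beta> n \<in> R" using \<beta> step.hyps by (auto simp: PiE_iff)
    have eq: "digits_ratio k n \<beta> = digits_ratio k n \<gamma>"
      unfolding \<gamma>_def by (rule prod.cong) auto
    have "ge 1 (digits_ratio k n \<gamma> - 1)"
      using ge_mono[OF digits_ratio_one_unit[OF R k(1) \<gamma>], of 1] k(1) by simp
    from digits_step[OF this n residue_repsD(1)[OF R \<beta>n], of r]
    have "ge (int n + 1) (digits_ratio k n \<gamma> - r - \<beta> n * p ^ n)"
      using \<beta> unfolding split eq by (simp add: add.commute)
    \<comment> \<open>The last digit is invisible modulo \<open>p ^ n\<close>, so the truncation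
      \<open>\<gamma>\<close> satisfies the congruence of the induction hypothesis.\<close>
    moreover have "ge (int n) (\<beta> n * p ^ n)"
      using ge_mult[OF residue_repsD(1)[OF R \<beta>n], of "int n" "p ^ n"] by (simp add: val_ge_def)
    ultimately have "ge (int n) (digits_ratio k n \<gamma> - r - \<beta> n * p ^ n + \<beta> n * p ^ n)"
      by (intro ge_add) (auto elim: ge_mono)
    then have g: "\<gamma> = \<alpha>" using \<alpha>_uniq[OF \<gamma>] by simp
    then have "\<beta> n = t" using t_uniq[OF \<beta>n] last[OF \<beta>n] \<beta> unfolding split eq q_def
      by (simp add: add.commute)
    show "\<beta> = \<alpha>(n := t)"
    proof
      fix i
      have "\<beta> i = undefined \<and> \<alpha> i = undefined" if "i \<notin> {k..<Suc n}"
        using that \<beta> \<alpha>(1) by (auto simp: PiE_iff extensional_def)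
      moreover have "\<beta> i = \<alpha> i" if "i \<in> {k..<n}"
        using that by (simp add: \<gamma>_def flip: g)
      moreover have "i = n \<or> i \<in> {k..<n} \<or> i \<notin> {k..<Suc n}" by auto
      ultimately show "\<beta> i = (\<alpha>(n := t)) i" using \<open>\<beta> n = t\<close> by (metis fun_upd_apply)
    qed
  qed
qed

text \<open>The pair \<open>(1, r)\<close> is a unit of ratio \<open>r\<close>, and the coset of a
  unit modulo \<open>L_order_units v p 1\<close> depends only on its ratio modulo
  \<open>p\<close>.\<close>

lemma unit_reps_ex1:
  assumes u0: "unit_reps v p u0" and r: "r \<noteq> 0" "v r = 0"
  shows "\<exists>!t. t \<in> R0 v p \<and> ge 1 (ratio (u0 t) - r)"
proof -
  have "(1, r) \<in> u0 t *o L_order_units v p 1 \<longleftrightarrow> ge 1 (ratio (u0 t) - r)"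
    if t: "t \<in> R0 v p" for t
  proof -
    obtain a b where ab: "u0 t = (a, b)" "a \<noteq> 0" "b \<noteq> 0" "v a = 0" "v b = 0"
      using u0 t unfolding unit_reps_def L_order_units_iff by (metis prod.collapse)
    have "(1, r) \<in> u0 t *o L_order_units v p 1 \<longleftrightarrow> (1 / a, r / b) \<in> L_order_units v p 1"
    proof
      assume "(1, r) \<in> u0 t *o L_order_units v p 1"
      then obtain c e where ce: "(c, e) \<in> L_order_units v p 1" "1 = a * c" "r = b * e"
        using ab by (auto simp: elt_set_times_def times_prod_def)
      have "1 / a = c" using ce(2) ab(2) by (simp add: field_simps)
      moreover have "r / b = e" using ce(3) ab(3) by (simp add: field_simps)
      ultimately show "(1 / a, r / b) \<in> L_order_units v p 1" using ce(1) by simp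
    next
      assume "(1 / a, r / b) \<in> L_order_units v p 1"
      then show "(1, r) \<in> u0 t *o L_order_units v p 1"
        using ab by (auto simp: elt_set_times_def times_prod_def intro!: bexI[of _ "(1 / a, r / b)"])
    qed
    also have "\<dots> \<longleftrightarrow> ge 1 (r / b - 1 / a)"
      using ab r by (simp add: L_order_units_iff val_divide)
    also have "r / b - 1 / a = (r - b / a) / b" using ab by (simp add: field_simps)
    also have "ge 1 \<dots> \<longleftrightarrow> ge 1 (ratio (u0 t) - r)"
      using ab ge_commute[of 1 r] by (simp add: ge_divide_iff ratio_def)
    finally show ?thesis .
  qed
  moreover have "(1, r) \<in> L_order_units v p 0"
    using r ge_diff[of 0 r 1] by (simp add: L_order_units_iff val_ge_def[of v 0 r])
  ultimately show ?thesis
    using u0 unfolding unit_reps_def by (metis (no_types, lifting))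
qed

section \<open>Full tuples and units modulo \<open>p ^ n\<close>\<close>

lemma u_full_units:
  assumes R: "residue_reps v p R" and u0: "unit_reps v p u0" and \<alpha>: "\<alpha> \<in> tuples v p R n"
  shows "fst (u_full p u0 n \<alpha>) \<noteq> 0 \<and> v (fst (u_full p u0 n \<alpha>)) = 0"
    "snd (u_full p u0 n \<alpha>) \<noteq> 0 \<and> v (snd (u_full p u0 n \<alpha>)) = 0"
proof -
  have u: "u0 (fst \<alpha>) \<in> L_order_units v p 0"
    using u0 \<alpha> by (auto simp: unit_reps_def tuples_def)
  have int: "ge 0 (snd \<alpha> i)" if "i \<in> {1..<n}" for i
    using that \<alpha> residue_repsD(1)[OF R] by (auto simp: tuples_def PiE_iff)
  let ?P = "\<Prod>i\<in>{1..<n}. u_elem p i (snd \<alpha> i)"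
  have "ge 1 (fst ?P - 1)" "ge 1 (snd ?P - 1)"
    unfolding fst_prod snd_prod using int
    by (auto intro!: one_units_prod ge_mono[OF u_elem_one_units(1)] ge_mono[OF u_elem_one_units(2)])
  from this[THEN one_unit] u
  show "fst (u_full p u0 n \<alpha>) \<noteq> 0 \<and> v (fst (u_full p u0 n \<alpha>)) = 0"
    "snd (u_full p u0 n \<alpha>) \<noteq> 0 \<and> v (snd (u_full p u0 n \<alpha>)) = 0"
    by (simp_all add: u_full_def L_order_units_iff val_mult)
qed

lemma ratio_u_full:
  "ratio (u_full p u0 n \<alpha>) = ratio (u0 (fst \<alpha>)) * digits_ratio 1 n (snd \<alpha>)"
  by (simp add: u_full_def ratio_mult ratio_prod)

text \<open>All factors after the first have ratio 1 modulo \<open>p\<close>, so \<open>r\<close>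
  modulo \<open>p\<close> determines the first entry \<open>t\<close>. The other digits are those of
  \<open>r / ratio (u0 t)\<close>, which is 1 modulo \<open>p\<close>.\<close>

lemma u_full_ex1:
  assumes R: "residue_reps v p R" and u0: "unit_reps v p u0" and n: "n \<ge> 1"
    and r: "r \<noteq> 0" "v r = 0"
  shows "\<exists>!\<alpha>. \<alpha> \<in> tuples v p R n \<and> ge (int n) (ratio (u_full p u0 n \<alpha>) - r)"
proof -
  have q: "ratio (u0 t) \<noteq> 0" "v (ratio (u0 t)) = 0" if "t \<in> R0 v p" for t
    using u0 that by (auto simp: unit_reps_def L_order_units_iff ratio_def val_divide)
  obtain t where t: "t \<in> R0 v p" "ge 1 (ratio (u0 t) - r)"
    and t_uniq: "\<And>s. s \<in> R0 v p \<Longrightarrow> ge 1 (ratio (u0 s) - r) \<Longrightarrow> s = t"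
    using unit_reps_ex1[OF u0 r] by (metis (no_types, lifting))
  let ?q = "ratio (u0 t)"
  have resc: "ge k (x - r / ?q) \<longleftrightarrow> ge k (?q * x - r)" for k x
  proof -
    have "x - r / ?q = (?q * x - r) / ?q" using q[OF t(1)] by (simp add: field_simps)
    then show ?thesis using q[OF t(1)] by (simp add: ge_divide_iff)
  qed
  have "ge 1 (r / ?q - 1)" using resc[of 1 1] t(2) ge_commute[of 1 1] by simp
  then have "\<exists>!\<alpha>. \<alpha> \<in> {1..<n} \<rightarrow>\<^sub>E R \<and> ge (int n) (?q * digits_ratio 1 n \<alpha> - r)"
    using digits_ratio_ex1[OF R order_refl n, of "r / ?q"] by (simp only: resc of_nat_1)
  then obtain \<alpha> where \<alpha>: "\<alpha> \<in> {1..<n} \<rightarrow>\<^sub>E R" "ge (int n) (?q * digits_ratio 1 n \<alpha> - r)"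
    and \<alpha>_uniq: "\<And>\<beta>. \<beta> \<in> {1..<n} \<rightarrow>\<^sub>E R \<Longrightarrow> ge (int n) (?q * digits_ratio 1 n \<beta> - r) \<Longrightarrow> \<beta> = \<alpha>"
    by (elim ex1E) blast
  show ?thesis
  proof (rule ex1I[of _ "(t, \<alpha>)"], intro conjI)
    show "(t, \<alpha>) \<in> tuples v p R n" using t \<alpha> by (simp add: tuples_def)
    show "ge (int n) (ratio (u_full p u0 n (t, \<alpha>)) - r)" using \<alpha> by (simp add: ratio_u_full)
  next
    fix x assume x: "x \<in> tuples v p R n \<and> ge (int n) (ratio (u_full p u0 n x) - r)"
    obtain s \<beta> where s: "x = (s, \<beta>)" "s \<in> R0 v p" "\<beta> \<in> {1..<n} \<rightarrow>\<^sub>E R"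
      using x by (auto simp: tuples_def)
    have g: "ge (int n) (ratio (u0 s) * digits_ratio 1 n \<beta> - r)"
      using x s by (simp add: ratio_u_full)
    have "ge 1 (ratio (u0 s) * (digits_ratio 1 n \<beta> - 1))"
      using digits_ratio_one_unit[OF R _ s(3)] q[OF s(2)] by (simp add: ge_mult_left_iff)
    from ge_diff[OF ge_mono[OF g, of 1] this] n have "ge 1 (ratio (u0 s) - r)"
      by (simp add: algebra_simps)
    then have "s = t" using t_uniq s by blast
    then show "x = (t, \<alpha>)" using \<alpha>_uniq s g by simp
  qed
qed

subsection \<open>The three parts\<close>

lemma hclass_u_full:
  assumes "residue_reps v p R" "unit_reps v p u0" "\<alpha> \<in> tuples v p R n"
  shows "hclass ((u_full p u0 n \<alpha> * (1, p powi m)) *o L_order v p n) =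
    ball_vertex (p powi m * ratio (u_full p u0 n \<alpha>)) (int n + m)"
  using u_full_units[OF assms] hclass_times_L_order[of "u_full p u0 n \<alpha> * (1, p powi m)" n]
  by (simp add: ratio_def val_mult mult.commute)

lemma u_full_bij_betw:
  assumes R: "residue_reps v p R" and u0: "unit_reps v p u0" and n: "n \<ge> 1"
  shows "bij_betw (\<lambda>(\<alpha>, m :: int). hclass ((u_full p u0 n \<alpha> * (1, p powi m)) *o L_order v p n))
       (tuples v p R n \<times> UNIV)
       {x \<in> bt_vertices v. apartment_dist v p x = enat n}"
  unfolding vertices_at_apartment_dist[OF n]
proof (rule bij_betwI')
  let ?f = "\<lambda>(\<alpha>, m :: int). hclass ((u_full p u0 n \<alpha> * (1, p powi m)) *o L_order v p n)"
  let ?\<rho> = "\<lambda>\<alpha>. ratio (u_full p u0 n \<alpha>)"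
  have \<rho>: "?\<rho> \<alpha> \<noteq> 0" "v (?\<rho> \<alpha>) = 0" if "\<alpha> \<in> tuples v p R n" for \<alpha>
    using u_full_units[OF R u0 that] by (simp_all add: ratio_def val_divide)
  {
    fix x y assume xy: "x \<in> tuples v p R n \<times> (UNIV :: int set)" "y \<in> tuples v p R n \<times> (UNIV :: int set)"
    obtain \<alpha> m \<beta> j where x: "x = (\<alpha>, m)" "y = (\<beta>, j)" by (metis surj_pair)
    have ab: "\<alpha> \<in> tuples v p R n" "\<beta> \<in> tuples v p R n" using xy x by auto
    show "?f x = ?f y \<longleftrightarrow> x = y"
    proof
      assume "?f x = ?f y"
      \<comment> \<open>The exponents \<open>int n + m\<close> and \<open>int n + j\<close> agree,
        which gives \<open>m = j\<close>; cancelling \<open>p powi m\<close> leaves a congruence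
        modulo \<open>p ^ n\<close>.\<close>
      then have "m = j" "ge (int n + m) (p powi m * (?\<rho> \<alpha> - ?\<rho> \<beta>))"
        by (auto simp: x hclass_u_full[OF R u0] ab ball_vertex_eq_iff right_diff_distrib)
      then have "m = j" "ge (int n) (?\<rho> \<alpha> - ?\<rho> \<beta>)" by (simp_all add: ge_mult_left_iff)
      moreover have "ge (int n) (?\<rho> \<beta> - ?\<rho> \<beta>)" by simp
      ultimately show "x = y"
        using u_full_ex1[OF R u0 n \<rho>[OF ab(2)]] ab x by blast
    qed simp
  next
    fix x assume "x \<in> tuples v p R n \<times> (UNIV :: int set)"
    then obtain \<alpha> m where x: "x = (\<alpha>, m)" "\<alpha> \<in> tuples v p R n" by auto
    let ?b = "p powi m * ?\<rho> \<alpha>"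
    have "?b \<noteq> 0" "v ?b = m" using \<rho>[OF x(2)] by (simp_all add: val_mult)
    then show "?f x \<in> {ball_vertex b (int n + v b) |b. b \<noteq> 0}"
      using x by (auto simp: hclass_u_full[OF R u0] intro!: exI[of _ ?b])
  next
    fix X assume "X \<in> {ball_vertex b (int n + v b) |b. b \<noteq> 0}"
    then obtain b where b: "X = ball_vertex b (int n + v b)" "b \<noteq> 0" by blast
    \<comment> \<open>The integer parameter is the valuation of the centre; the remaining unit part
      is matched by \<open>u_full\<close>.\<close>
    let ?r = "b / p powi v b"
    have "?r \<noteq> 0" "v ?r = 0" using b by (simp_all add: val_divide)
    from u_full_ex1[OF R u0 n this]
    obtain \<alpha> where \<alpha>: "\<alpha> \<in> tuples v p R n" "ge (int n) (?\<rho> \<alpha> - ?r)" by blast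
    have "p powi v b * ?\<rho> \<alpha> - b = p powi v b * (?\<rho> \<alpha> - ?r)" by (simp add: field_simps)
    then have "ge (int n + v b) (p powi v b * ?\<rho> \<alpha> - b)"
      using \<alpha>(2) by (simp add: ge_mult_left_iff)
    then have "X = ?f (\<alpha>, v b)"
      using \<alpha>(1) b by (simp add: hclass_u_full[OF R u0] ball_vertex_eq_iff ge_commute)
    then show "\<exists>x\<in>tuples v p R n \<times> UNIV. X = ?f x" using \<alpha>(1) by blast
  }
qed

text \<open>By \<open>d < n\<close> all indices are at least 1, so both coordinates of the product
  are 1 modulo \<open>p\<close>, and multiplication moves the centre without changing the
  exponent.\<close>

lemma hclass_u_partial:
  assumes R: "residue_reps v p R" and \<alpha>: "\<alpha> \<in> partial_tuples R n d" and d: "d < n"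
  shows "hclass (u_partial p n d \<alpha> *o L_order v p n) =
    ball_vertex (digits_ratio (n - d) n \<alpha>) (int n)"
proof -
  have int: "ge 0 (\<alpha> i)" if "i \<in> {n - d..<n}" for i
    using that \<alpha> residue_repsD(1)[OF R] by (auto simp: partial_tuples_def PiE_iff)
  have "ge 1 (fst (u_partial p n d \<alpha>) - 1)" "ge 1 (snd (u_partial p n d \<alpha>) - 1)"
    unfolding u_partial_def fst_prod snd_prod using int d
    by (auto intro!: one_units_prod ge_mono[OF u_elem_one_units(1)] ge_mono[OF u_elem_one_units(2)])
  from this[THEN one_unit] hclass_times_L_order[of "u_partial p n d \<alpha>" n]
  have "hclass (u_partial p n d \<alpha> *o L_order v p n) =
      ball_vertex (ratio (u_partial p n d \<alpha>)) (int n)"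
    by (simp add: ratio_def)
  then show ?thesis by (simp add: u_partial_def ratio_prod)
qed

lemma u_partial_bij_betw:
  assumes R: "residue_reps v p R" and d: "d < n"
  shows "bij_betw (\<lambda>\<alpha>. hclass (u_partial p n d \<alpha> *o L_order v p n))
         (partial_tuples R n d)
         {x \<in> bt_vertices v. bt_dist v p x (hclass (L_order v p (n - d))) = enat d \<and>
            (\<forall>xs. bt_geodesic v p x xs (hclass (L_order v p (n - d))) \<longrightarrow>
               hclass (L_order v p (n - d - 1)) \<notin> set xs)}"
proof -
  define k where "k = n - d"
  \<comment> \<open>Positivity of \<open>k\<close> makes the natural subtraction in the forbidden
    vertex agree with the integer exponent \<open>int k - 1\<close>.\<close>
  have k: "1 \<le> k" "k \<le> n" "int (k - 1) = int k - 1" "int k + int d = int n"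
    using d by (auto simp: k_def)
  have pt: "partial_tuples R n d = ({k..<n} \<rightarrow>\<^sub>E R)" by (simp add: partial_tuples_def k_def)
  have cl: "hclass (u_partial p n d \<alpha> *o L_order v p n) = ball_vertex (digits_ratio k n \<alpha>) (int n)"
    if "\<alpha> \<in> {k..<n} \<rightarrow>\<^sub>E R" for \<alpha>
    using hclass_u_partial[OF R _ d] that by (simp add: pt k_def[symmetric])
  show ?thesis
    unfolding hclass_L_order k(3) k_def[symmetric] vertices_beyond_ball k(4) pt
  proof (rule bij_betwI')
    fix \<alpha> \<beta> assume ab: "\<alpha> \<in> {k..<n} \<rightarrow>\<^sub>E R" "\<beta> \<in> {k..<n} \<rightarrow>\<^sub>E R"
    have "\<alpha> = \<beta>" if "ge (int n) (digits_ratio k n \<alpha> - digits_ratio k n \<beta>)"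
    proof -
      have "ge (int n) (digits_ratio k n \<beta> - digits_ratio k n \<beta>)" by simp
      then show ?thesis
        using digits_ratio_ex1[OF R k(1,2) digits_ratio_one_unit[OF R k(1) ab(2)]] ab that by blast
    qed
    then show "hclass (u_partial p n d \<alpha> *o L_order v p n) =
        hclass (u_partial p n d \<beta> *o L_order v p n) \<longleftrightarrow> \<alpha> = \<beta>"
      using ab by (auto simp: cl ball_vertex_eq_iff)
  next
    fix \<alpha> assume "\<alpha> \<in> {k..<n} \<rightarrow>\<^sub>E R"
    then show "hclass (u_partial p n d \<alpha> *o L_order v p n) \<in>
        {ball_vertex b (int n) |b. ge (int k) (b - 1)}"
      using digits_ratio_one_unit[OF R k(1)] cl by blast
  next
    fix X assume "X \<in> {ball_vertex b (int n) |b. ge (int k) (b - 1)}"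
    then obtain b where b: "X = ball_vertex b (int n)" "ge (int k) (b - 1)" by blast
    obtain \<alpha> where \<alpha>: "\<alpha> \<in> {k..<n} \<rightarrow>\<^sub>E R" "ge (int n) (digits_ratio k n \<alpha> - b)"
      using digits_ratio_ex1[OF R k(1,2) b(2)] by blast
    then have "X = hclass (u_partial p n d \<alpha> *o L_order v p n)"
      using b by (simp add: cl ball_vertex_eq_iff ge_commute)
    then show "\<exists>\<alpha>\<in>{k..<n} \<rightarrow>\<^sub>E R. X = hclass (u_partial p n d \<alpha> *o L_order v p n)"
      using \<alpha>(1) by blast
  qed
qed

text \<open>A generator with a zero coordinate gives infinite index, because the scalars
  \<open>p\<^sup>j\<close> then lie in distinct classes.\<close>

lemma finite_index_nonzero:
  assumes fin: "finite (L_order v p n //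
      {(x, y). x \<in> L_order v p n \<and> y \<in> L_order v p n \<and> x - y \<in> z *o L_order v p n})"
  shows "fst z \<noteq> 0" "snd z \<noteq> 0"
proof -
  let ?O = "L_order v p n"
  let ?r = "{(x, y). x \<in> ?O \<and> y \<in> ?O \<and> x - y \<in> z *o ?O}"
  have O: "diag (p ^ j) \<in> ?O" for j
    by (simp add: L_order_eq_lat lat_def diag_def val_ge_def)
  \<comment> \<open>By pigeonhole two distinct powers fall into one class. Their difference is a
    nonzero scalar in the ideal, which excludes a zero coordinate of \<open>z\<close>.\<close>
  have "\<not> inj (\<lambda>j. ?r `` {diag (p ^ j)})"
  proof
    assume "inj (\<lambda>j. ?r `` {diag (p ^ j)})"
    moreover have "range (\<lambda>j. ?r `` {diag (p ^ j)}) \<subseteq> ?O // ?r"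
      using quotientI[OF O] by blast
    ultimately show False using fin by (meson finite_imageD finite_subset infinite_UNIV_nat)
  qed
  then obtain i j where ij: "i \<noteq> j" "?r `` {diag (p ^ i)} = ?r `` {diag (p ^ j)}"
    unfolding inj_def by blast
  have "diag (p ^ j) \<in> ?r `` {diag (p ^ j)}"
  proof -
    have "(0 :: 'a \<times> 'a) \<in> ?O" by (simp add: L_order_eq_lat lat_def zero_prod_def)
    then have "(0 :: 'a \<times> 'a) \<in> z *o ?O" by (auto simp: elt_set_times_def intro!: bexI[of _ 0])
    then show ?thesis using O by simp
  qed
  then have "diag (p ^ i) - diag (p ^ j) \<in> z *o ?O" using ij(2) by auto
  moreover have "p ^ i - p ^ j \<noteq> 0" using ij(1) val_power by (metis eq_iff_diff_eq_0 of_nat_eq_iff)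
  ultimately show "fst z \<noteq> 0" "snd z \<noteq> 0"
    by (auto simp: elt_set_times_def diag_def prod_eq_iff)
qed

text \<open>The coordinates of a generator agree modulo \<open>p ^ n\<close>, and lowness puts their
  common valuation below \<open>n\<close>. Hence \<open>b / a\<close> is 1 modulo \<open>p\<close>
  and the class is a ball of exponent \<open>n\<close> inside the ball of 1 with exponent 1.\<close>

lemma low_ideal_class:
  assumes R: "residue_reps v p R" and n: "n \<ge> 1"
    and I: "low_ideal v p n I" "\<not> (n = 1 \<and> I = L_order v p n)"
  shows "\<exists>d. 1 \<le> d \<and> d \<le> n - 1 \<and>
         (\<exists>\<alpha> \<in> partial_tuples R n d. hclass I = hclass (u_partial p n d \<alpha> *o L_order v p n))"
proof -
  obtain a b where ab: "(a, b) \<in> L_order v p n" "I = (a, b) *o L_order v p n"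
    and fin: "finite (L_order v p n //
      {(x, y). x \<in> L_order v p n \<and> y \<in> L_order v p n \<and> x - y \<in> I})"
    and low: "\<not> (ge (int n) a \<and> ge (int n) b)"
    using I(1) unfolding low_ideal_def by blast
  have nz: "a \<noteq> 0" "b \<noteq> 0" using finite_index_nonzero[of n "(a, b)"] fin ab(2) by simp_all
  have a0: "ge 0 a" and diff: "ge (int n) (b - a)"
    using ab(1) by (auto simp: L_order_eq_lat lat_def)
  \<comment> \<open>Otherwise \<open>b = (b - a) + a\<close> would be divisible by
    \<open>p ^ n\<close> together with \<open>a\<close>.\<close>
  have "v a < int n"
    using low ge_add[OF diff, of a] ge_nonzero[OF nz(1), of "int n"] by force
  then have v: "v b = v a" using val_eqI[OF diff nz(1)] by simp
  have "b / a - 1 = (b - a) / a" using nz by (simp add: field_simps)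
  then have r: "ge 1 (b / a - 1)"
    using ge_mono[OF diff, of "1 + v a"] \<open>v a < int n\<close> nz by (simp add: ge_divide_iff)
  have cl: "hclass I = ball_vertex (b / a) (int n)"
    using hclass_times_L_order[of "(a, b)" n] nz v ab(2) by simp
  show ?thesis
  proof (cases "n = 1")
    case True
    \<comment> \<open>For \<open>n = 1\<close> the generator is a unit of the order, so the ideal is
      the whole order, the excluded case.\<close>
    then have "v a = 0" using \<open>v a < int n\<close> a0 nz by (simp add: val_ge_def)
    then have "I = lat 0 (b / a) (int n)"
      using ab(2) times_lat[OF nz, of 0 1 "int n"] v by (simp add: L_order_eq_lat)
    also have "\<dots> = L_order v p n" using r True by (simp add: L_order_eq_lat lat_eq_iff)
    finally show ?thesis using I(2) True by blast
  next
    case False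
    \<comment> \<open>The largest value \<open>d = n - 1\<close> covers all these balls at once,
      since its digits start at index 1.\<close>
    then have d: "1 \<le> n - 1" "n - 1 < n" "n - (n - 1) = 1" using n by auto
    obtain \<alpha> where \<alpha>: "\<alpha> \<in> {1..<n} \<rightarrow>\<^sub>E R" "ge (int n) (digits_ratio 1 n \<alpha> - b / a)"
      using digits_ratio_ex1[OF R _ n, of "b / a"] r by auto
    then have pt: "\<alpha> \<in> partial_tuples R n (n - 1)" using d by (simp add: partial_tuples_def)
    have "hclass I = hclass (u_partial p n (n - 1) \<alpha> *o L_order v p n)"
      using hclass_u_partial[OF R pt d(2)] \<alpha>(2) cl unfolding d(3)
      by (simp add: ball_vertex_eq_iff ge_commute)
    then show ?thesis using pt d by blast
  qed
qed

end

theorem theorem5p30: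
  fixes v :: "'a::field_char_0 \<Rightarrow> int" and p :: 'a and R :: "'a set"
    and u0 :: "nat \<Rightarrow> 'a \<times> 'a" and n :: nat
  assumes "local_field v" and "uniformizer v p"
    and "residue_reps v p R" and "unit_reps v p u0"
    and "n \<ge> 1"
  shows
    "bij_betw (\<lambda>(\<alpha>, m :: int). hclass ((u_full p u0 n \<alpha> * (1, p powi m)) *o L_order v p n))
       (tuples v p R n \<times> UNIV)
       {x \<in> bt_vertices v. apartment_dist v p x = enat n} \<and>
     (\<forall>d. 1 \<le> d \<and> d \<le> n - 1 \<longrightarrow>
       bij_betw (\<lambda>\<alpha>. hclass (u_partial p n d \<alpha> *o L_order v p n))
         (partial_tuples R n d)
         {x \<in> bt_vertices v. bt_dist v p x (hclass (L_order v p (n - d))) = enat d \<and>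
            (\<forall>xs. bt_geodesic v p x xs (hclass (L_order v p (n - d))) \<longrightarrow>
               hclass (L_order v p (n - d - 1)) \<notin> set xs)}) \<and>
     (\<forall>I. low_ideal v p n I \<and> \<not> (n = 1 \<and> I = L_order v p n) \<longrightarrow>
       (\<exists>d. 1 \<le> d \<and> d \<le> n - 1 \<and>
         (\<exists>\<alpha> \<in> partial_tuples R n d. hclass I = hclass (u_partial p n d \<alpha> *o L_order v p n))))"
proof -
  interpret uniformized_local_field v p
    using assms(1,2) by (rule uniformized_local_field.intro[OF _ uniformized_local_field_axioms.intro])
  show ?thesis
  proof (intro conjI allI impI, goal_cases)
    case 1
    show ?case by (rule u_full_bij_betw[OF assms(3-5)])
  next
    case (2 d)
    then have "d < n" using assms(5) by linarith
    then show ?case by (rule u_partial_bij_betw[OF assms(3)])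
  next
    case (3 I)
    then show ?case using low_ideal_class[OF assms(3,5)] by meson
  qed
qed

end
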